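(* Let $X$ and $Y$ be Tychonoff spaces, and let $D$ stand either for $C$ or for $C^*$, so that $D_p(X), D_p(Y)$ are $C_p(X), C_p(Y)$ or $C_p^*(X), C_p^*(Y)$ respectively. Let $T:D_p(X)\to D_p(Y)$ be a uniformly continuous surjection which is $c$-good for some $c>0$. If $X$ is $0$-dimensional (i.e. $\dim X=0$), then $Y$ is $0$-dimensional (i.e. $\dim Y=0$).
   Context: All spaces are (non-empty) Tychonoff spaces. $C(X)$ (resp. $C^*(X)$) is the set of all continuous (resp. continuous and bounded) real-valued functions on $X$; $C_p(X)$ (resp. $C_p^*(X)$) is this set endowed with the topology of pointwise convergence. $\dim$ is the covering dimension defined by finite functionally open covers: $\dim X\le n$ if every finite cover of $X$ by functionally open sets (cozero sets) has a finite functionally open refinement such that each point lies in at most $n+1$ of its members. A space is $0$-dimensional if its covering dimension $\dim$ is $0$. A map $T:D_p(X)\to D_p(Y)$ (not necessarily linear) is uniformly continuous if for every neighborhood $U$ of the zero function in $D_p(Y)$ there is a neighborhood $V$ of the zero function in $D_p(X)$ such that $f,g\in D_p(X)$ and $f-g\in V$ imply $T(f)-T(g)\in U$. For a bounded function $f$, $\|f\|$ is its supremum norm. For $c>0$, $T$ is $c$-good if for every bounded function $g\in D_p(Y)$ there is a bounded function $f\in D_p(X)$ with $T(f)=g$ and $\|f\|\le c\|g\|$. *)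

theory Defs
  imports "HOL-Analysis.Analysis" "HOL-Library.Extended_Nat"
begin

definition tychonoff_space :: "'a topology \<Rightarrow> bool" where
  "tychonoff_space X \<longleftrightarrow> completely_regular_space X \<and> t1_space X"

definition functionally_open_in :: "'a topology \<Rightarrow> 'a set \<Rightarrow> bool" where
  "functionally_open_in X U \<longleftrightarrow>
     (\<exists>h. continuous_map X euclideanreal h \<and> U = {x \<in> topspace X. h x \<noteq> 0})"

definition finite_functionally_open_cover :: "'a topology \<Rightarrow> 'a set set \<Rightarrow> bool" where
  "finite_functionally_open_cover X \<U> \<longleftrightarrow>
     finite \<U> \<and> (\<forall>U\<in>\<U>. functionally_open_in X U) \<and> \<Union>\<U> = topspace X"

definition covering_dim_le :: "'a topology \<Rightarrow> nat \<Rightarrow> bool" where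
  "covering_dim_le X n \<longleftrightarrow>
     (\<forall>\<U>. finite_functionally_open_cover X \<U> \<longrightarrow>
        (\<exists>\<V>. finite_functionally_open_cover X \<V> \<and> (\<forall>V\<in>\<V>. \<exists>U\<in>\<U>. V \<subseteq> U) \<and>
             (\<forall>x\<in>topspace X. card {V \<in> \<V>. x \<in> V} \<le> n + 1)))"

text \<open>
  The dimension is meant for non-empty spaces only: the convention that the empty space has
  dimension -1 is not represented. The infimum of the empty set is \<open>\<infinity>\<close>.
\<close>

definition covering_dim :: "'a topology \<Rightarrow> enat" where
  "covering_dim X = (INF n\<in>{n. covering_dim_le X n}. enat n)"

definition zero_dimensional :: "'a topology \<Rightarrow> bool" where
  "zero_dimensional X \<longleftrightarrow> covering_dim X = 0"

text \<open>
  A real-valued function on \<open>X\<close> is represented by its extensional representative, which is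
  \<open>undefined\<close> outside \<open>topspace X\<close>. This makes the representation unique and agrees with the
  carrier of \<open>powertop_real (topspace X)\<close>. \<open>All_Continuous\<close> and \<open>Bounded_Continuous\<close> are the two
  possible meanings $C$ and $C^*$ of the letter $D$.
\<close>

datatype function_class = All_Continuous | Bounded_Continuous

definition bounded_on_space :: "'a topology \<Rightarrow> ('a \<Rightarrow> real) \<Rightarrow> bool" where
  "bounded_on_space X f \<longleftrightarrow> bounded (f ` topspace X)"

fun function_set :: "function_class \<Rightarrow> 'a topology \<Rightarrow> ('a \<Rightarrow> real) set" where
  "function_set All_Continuous X =
     {f \<in> extensional (topspace X). continuous_map X euclideanreal f}"
| "function_set Bounded_Continuous X =
     {f \<in> extensional (topspace X). continuous_map X euclideanreal f \<and> bounded_on_space X f}"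

definition pointwise_space :: "function_class \<Rightarrow> 'a topology \<Rightarrow> ('a \<Rightarrow> real) topology" where
  "pointwise_space D X = subtopology (powertop_real (topspace X)) (function_set D X)"

lemma topspace_pointwise_space [simp]: "topspace (pointwise_space D X) = function_set D X"
  by (cases D) (auto simp: pointwise_space_def PiE_def)

definition zero_fun :: "'a topology \<Rightarrow> 'a \<Rightarrow> real" where
  "zero_fun X = (\<lambda>x\<in>topspace X. 0)"

definition diff_fun :: "'a topology \<Rightarrow> ('a \<Rightarrow> real) \<Rightarrow> ('a \<Rightarrow> real) \<Rightarrow> 'a \<Rightarrow> real" where
  "diff_fun X f g = (\<lambda>x\<in>topspace X. f x - g x)"

definition uniformly_continuous_Dp ::
  "function_class \<Rightarrow> 'a topology \<Rightarrow> 'b topology \<Rightarrow> (('a \<Rightarrow> real) \<Rightarrow> ('b \<Rightarrow> real)) \<Rightarrow> bool" where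
  "uniformly_continuous_Dp D X Y T \<longleftrightarrow>
     (\<forall>U. openin (pointwise_space D Y) U \<and> zero_fun Y \<in> U \<longrightarrow>
        (\<exists>V. openin (pointwise_space D X) V \<and> zero_fun X \<in> V \<and>
             (\<forall>f\<in>function_set D X. \<forall>g\<in>function_set D X.
                diff_fun X f g \<in> V \<longrightarrow> diff_fun Y (T f) (T g) \<in> U)))"

text \<open>Only meaningful for bounded \<open>f\<close> on a non-empty space.\<close>

definition sup_norm :: "'a topology \<Rightarrow> ('a \<Rightarrow> real) \<Rightarrow> real" where
  "sup_norm X f = (SUP x\<in>topspace X. \<bar>f x\<bar>)"

definition c_good ::
  "real \<Rightarrow> function_class \<Rightarrow> 'a topology \<Rightarrow> 'b topology \<Rightarrow> (('a \<Rightarrow> real) \<Rightarrow> ('b \<Rightarrow> real)) \<Rightarrow> bool" where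
  "c_good c D X Y T \<longleftrightarrow>
     (\<forall>g\<in>function_set D Y. bounded_on_space Y g \<longrightarrow>
        (\<exists>f\<in>function_set D X. bounded_on_space X f \<and> T f = g \<and> sup_norm X f \<le> c * sup_norm Y g))"

end

theory Submission
  imports Defs
begin

text \<open>
  Write \<open>Z\<close> and \<open>W\<close> for the Stone-Cech compactifications of \<open>X\<close> and \<open>Y\<close>. Restricting
  functions from \<open>Z\<close> to \<open>X\<close> turns \<open>T\<close> into an operator \<open>S\<close> from \<open>C(Z)\<close> to \<open>C(Y)\<close>. Uniform
  continuity says that \<open>S f y\<close> depends, up to a bounded error, on the values of \<open>f\<close> on a finite
  set only. A finite set \<open>K\<close> is called a \<open>q\<close>-support of a point \<open>w\<close> of \<open>W\<close> if
  \<open>\<bar>f - g\<bar> < 1\<close> on \<open>K\<close> forces \<open>\<bar>S f - S g\<bar> \<le> q\<close> at \<open>w\<close> in the limit sense. The set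
  \<open>M p q\<close> (below: \<open>supported p q\<close>) of the points with a \<open>q\<close>-support of at most \<open>p\<close> elements is closed, because \<open>Z\<close> is compact, and the
  sets \<open>M p q\<close> with \<open>p, q\<close> natural cover \<open>Y\<close>.

  Two facts about supports carry the proof. If \<open>K\<close> is a \<open>q\<close>-support and \<open>L\<close> an
  \<open>r\<close>-support of \<open>w\<close>, then \<open>K \<inter> L\<close> is a \<open>(q + r)\<close>-support of \<open>w\<close> (\<open>supports_Int\<close>): interpolate
  between two functions that are close on \<open>K \<inter> L\<close>. Hence on a closed subset \<open>F\<close> of
  \<open>M (p + 1) q\<close> that misses \<open>M p (2 * q)\<close> the support is unique, and the relation between points
  and their supports is closed. As \<open>Z\<close> has enough clopen sets, the support is constant on every connected
  subset of \<open>F\<close>. Secondly, a connected set all of whose points share one finite support is a single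
  point (\<open>connected_common_support_trivial\<close>): otherwise there are infinitely many functions on \<open>Y\<close>,
  uniformly bounded, any two of which differ by more than \<open>q\<close> somewhere on that set;
  by \<open>c\<close>-goodness they have uniformly bounded preimages, two of which are close on the finite
  support. So \<open>F\<close> is compact and totally disconnected, that is, zero-dimensional.

  It remains to add up. Let a set be zero-dimensional in \<open>W\<close> if every pair of disjoint closed
  sets of \<open>W\<close> has neighbourhoods with disjoint closures that cover the set. This notion passes from
  \<open>M p (2 * q)\<close> together with the sets \<open>F\<close> to \<open>M (p + 1) q\<close>, so that all \<open>M p q\<close> have it by induction
  on \<open>p\<close>; and countably many such steps separate two closed sets of \<open>W\<close> by disjoint open sets that
  cover the union of all \<open>M p q\<close>, hence \<open>Y\<close>. Their traces on \<open>Y\<close> are clopen. This is the clopen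
  separation of functionally separated sets in \<open>Y\<close>, which is equivalent to \<open>dim Y = 0\<close>.
\<close>

section \<open>The Stone-Cech compactification\<close>

definition bounded_continuous :: "'a topology \<Rightarrow> ('a \<Rightarrow> real) \<Rightarrow> bool" where
  "bounded_continuous X h \<longleftrightarrow> continuous_map X euclideanreal h \<and> bounded_on_space X h"

definition evaluation_at :: "'a topology \<Rightarrow> 'a \<Rightarrow> ('a \<Rightarrow> real) \<Rightarrow> real" where
  "evaluation_at X x = (\<lambda>f\<in>function_set Bounded_Continuous X. f x)"

text \<open>
  The Stone-Cech compactification is realised as a set of functionals on the bounded continuous
  functions: the pointwise closure of the evaluations. The continuous extension of \<open>h\<close> is then just
  evaluation of the functional at \<open>h\<close>.
\<close>

definition stone_cech :: "'a topology \<Rightarrow> (('a \<Rightarrow> real) \<Rightarrow> real) topology" where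
  "stone_cech X =
     subtopology (powertop_real (function_set Bounded_Continuous X))
       (powertop_real (function_set Bounded_Continuous X) closure_of (evaluation_at X ` topspace X))"

definition sc_extension :: "'a topology \<Rightarrow> ('a \<Rightarrow> real) \<Rightarrow> (('a \<Rightarrow> real) \<Rightarrow> real) \<Rightarrow> real" where
  "sc_extension X h w = w (restrict h (topspace X))"

lemma bounded_continuousI:
  assumes "continuous_map X euclideanreal h" "\<And>x. x \<in> topspace X \<Longrightarrow> \<bar>h x\<bar> \<le> r"
  shows "bounded_continuous X h"
  using assms by (auto simp: bounded_continuous_def bounded_on_space_def bounded_real)

lemma restrict_bounded_continuous:
  assumes "bounded_continuous X h"
  shows "restrict h (topspace X) \<in> function_set Bounded_Continuous X"
proof -
  have "continuous_map X euclideanreal (restrict h (topspace X))"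
    using assms continuous_map_eq[of X euclideanreal h] by (simp add: bounded_continuous_def)
  then show ?thesis
    using assms by (simp add: bounded_continuous_def bounded_on_space_def)
qed

lemma Hausdorff_stone_cech: "Hausdorff_space (stone_cech X)"
  unfolding stone_cech_def
  by (intro Hausdorff_space_subtopology) (simp add: Hausdorff_space_product_topology)

text \<open>
  The evaluations lie in the product of the intervals \<open>{- r f..r f}\<close>, where \<open>r f\<close> bounds \<open>\<bar>f\<bar>\<close>, and
  this product is compact by Tychonoff's theorem.
\<close>

lemma compact_stone_cech: "compact_space (stone_cech X)"
proof -
  let ?C = "function_set Bounded_Continuous X"
  have "\<exists>r. \<forall>x\<in>topspace X. \<bar>f x\<bar> \<le> r" if "f \<in> ?C" for f
    using that by (auto simp: bounded_on_space_def bounded_real)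
  then obtain r where r: "\<And>f x. f \<in> ?C \<Longrightarrow> x \<in> topspace X \<Longrightarrow> \<bar>f x\<bar> \<le> r f"
    by metis
  let ?B = "\<Pi>\<^sub>E f\<in>?C. {- r f..r f}"
  have comp: "compactin (powertop_real ?C) ?B"
    by (simp add: compactin_PiE)
  moreover have "closedin (powertop_real ?C) ?B"
    by (intro compactin_imp_closedin comp) (simp add: Hausdorff_space_product_topology)
  moreover have "evaluation_at X ` topspace X \<subseteq> ?B"
    using r by (auto simp: evaluation_at_def abs_le_iff minus_le_iff simp del: function_set.simps)
  ultimately have "powertop_real ?C closure_of (evaluation_at X ` topspace X) \<subseteq> ?B"
    by (simp add: closure_of_minimal)
  then have "compactin (powertop_real ?C) (powertop_real ?C closure_of (evaluation_at X ` topspace X))"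
    using comp closed_compactin closedin_closure_of by blast
  then show ?thesis
    by (simp add: stone_cech_def compact_space_subtopology)
qed

lemma evaluation_at_in_stone_cech:
  assumes "x \<in> topspace X"
  shows "evaluation_at X x \<in> topspace (stone_cech X)"
proof -
  have "evaluation_at X ` topspace X \<subseteq> topspace (powertop_real (function_set Bounded_Continuous X))"
    by (auto simp: evaluation_at_def)
  from closure_of_subset[OF this] show ?thesis
    using assms by (auto simp: stone_cech_def evaluation_at_def simp del: function_set.simps)
qed

lemma continuous_map_evaluation_at: "continuous_map X (stone_cech X) (evaluation_at X)"
proof -
  have "continuous_map X (powertop_real (function_set Bounded_Continuous X)) (evaluation_at X)"
    unfolding continuous_map_componentwise evaluation_at_def by auto
  then show ?thesis
    using evaluation_at_in_stone_cech[of _ X]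
    unfolding stone_cech_def topspace_subtopology continuous_map_in_subtopology by blast
qed

text \<open>
  Density of the evaluations, in the form in which it transfers closed conditions from the space to
  its compactification.
\<close>

lemma stone_cech_dense:
  assumes "closedin (stone_cech X) A" "\<And>x. x \<in> topspace X \<Longrightarrow> evaluation_at X x \<in> A"
    and "w \<in> topspace (stone_cech X)"
  shows "w \<in> A"
proof -
  let ?P = "powertop_real (function_set Bounded_Continuous X)"
  have "closedin ?P A"
    using assms(1) unfolding stone_cech_def
    by (meson closedin_closure_of closedin_trans_full)
  then have "?P closure_of (evaluation_at X ` topspace X) \<subseteq> A"
    using assms(2) by (intro closure_of_minimal) auto
  then show ?thesis
    using assms(3) by (auto simp: stone_cech_def)
qed

lemma sc_extension_evaluation_at:
  assumes "bounded_continuous X h" "x \<in> topspace X"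
  shows "sc_extension X h (evaluation_at X x) = h x"
  using restrict_bounded_continuous[OF assms(1)] assms(2)
  by (simp add: sc_extension_def evaluation_at_def del: function_set.simps)

lemma continuous_sc_extension:
  assumes "bounded_continuous X h"
  shows "continuous_map (stone_cech X) euclideanreal (sc_extension X h)"
  unfolding stone_cech_def sc_extension_def
  by (intro continuous_map_from_subtopology continuous_map_product_projection
      restrict_bounded_continuous assms)

lemma sc_extension_unique:
  assumes h: "bounded_continuous X h"
    and \<phi>: "continuous_map (stone_cech X) euclideanreal \<phi>"
    and eq: "\<And>x. x \<in> topspace X \<Longrightarrow> \<phi> (evaluation_at X x) = h x"
    and w: "w \<in> topspace (stone_cech X)"
  shows "sc_extension X h w = \<phi> w"
proof -
  have "closedin (stone_cech X) {w \<in> topspace (stone_cech X). sc_extension X h w = \<phi> w}"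
    using closedin_continuous_maps_eq[OF _ continuous_sc_extension[OF h] \<phi>] by simp
  from stone_cech_dense[OF this _ w] show ?thesis
    using eq by (simp add: sc_extension_evaluation_at[OF h] evaluation_at_in_stone_cech)
qed

lemma sc_extension_le:
  assumes h: "bounded_continuous X h"
    and \<phi>: "continuous_map (stone_cech X) euclideanreal \<phi>"
    and le: "\<And>x. x \<in> topspace X \<Longrightarrow> h x \<le> \<phi> (evaluation_at X x)"
    and w: "w \<in> topspace (stone_cech X)"
  shows "sc_extension X h w \<le> \<phi> w"
proof -
  have "closedin (stone_cech X) {w \<in> topspace (stone_cech X). \<phi> w - sc_extension X h w \<in> {0..}}"
    by (intro closedin_continuous_map_preimage[where Y=euclideanreal] continuous_map_diff \<phi>
        continuous_sc_extension h) simp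
  from stone_cech_dense[OF this _ w] show ?thesis
    using le by (simp add: sc_extension_evaluation_at[OF h] evaluation_at_in_stone_cech)
qed

lemma stone_cech_separated:
  assumes "v \<in> topspace (stone_cech X)" "w \<in> topspace (stone_cech X)" "v \<noteq> w"
  obtains h where "bounded_continuous X h" "sc_extension X h v < sc_extension X h w"
proof -
  let ?C = "function_set Bounded_Continuous X"
  have "v \<in> extensional ?C" "w \<in> extensional ?C"
    using assms by (auto simp: stone_cech_def PiE_def simp del: function_set.simps)
  then obtain f where f: "f \<in> ?C" "v f \<noteq> w f"
    using \<open>v \<noteq> w\<close> extensionalityI by metis
  have bc: "bounded_continuous X f" and r: "restrict f (topspace X) = f"
    using f by (auto simp: bounded_continuous_def extensional_restrict)
  let ?u = "\<lambda>x. - f x"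
  have bu: "bounded_continuous X ?u"
    using bc continuous_map_minus[of X f] by (force simp: bounded_continuous_def bounded_on_space_def bounded_real)
  have neg: "sc_extension X ?u z = - sc_extension X f z" if "z \<in> topspace (stone_cech X)" for z
    by (rule sc_extension_unique[OF bu _ _ that])
      (auto intro!: continuous_map_minus continuous_sc_extension simp: bc sc_extension_evaluation_at)
  show ?thesis
  proof (cases "v f < w f")
    case True
    then show ?thesis using that[OF bc] by (simp add: sc_extension_def r)
  next
    case False
    then have "sc_extension X f w < sc_extension X f v"
      using f(2) by (simp add: sc_extension_def r)
    then show ?thesis using that[OF bu] neg assms by simp
  qed
qed

section \<open>Zero-dimensional parts of a normal space\<close>

text \<open>
  For a closed \<open>M\<close> in a normal space this says that disjoint closed subsets of \<open>M\<close> are separated by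
  a clopen subset of \<open>M\<close>. Quantifying over the closed sets of the whole space and asking for disjoint
  closures lets the separation of one set be the starting point for the separation of the next.
\<close>

definition zero_dimensional_in :: "'a topology \<Rightarrow> 'a set \<Rightarrow> bool" where
  "zero_dimensional_in W M \<longleftrightarrow>
     (\<forall>A B. closedin W A \<and> closedin W B \<and> disjnt A B \<longrightarrow>
        (\<exists>U V. openin W U \<and> openin W V \<and> A \<subseteq> U \<and> B \<subseteq> V \<and> M \<subseteq> U \<union> V \<and>
               disjnt (W closure_of U) (W closure_of V)))"

lemma zero_dimensional_inE:
  assumes "zero_dimensional_in W M" "closedin W A" "closedin W B" "disjnt A B"
  obtains U V where "openin W U" "openin W V" "A \<subseteq> U" "B \<subseteq> V" "M \<subseteq> U \<union> V"
    "disjnt (W closure_of U) (W closure_of V)"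
  using assms unfolding zero_dimensional_in_def by meson

text \<open>
  Separate first across \<open>N\<close>. What the two neighbourhoods leave uncovered of \<open>M\<close> is closed and disjoint from
  \<open>N\<close>, and the closures of the two neighbourhoods can be separated again across this remainder.
\<close>

lemma zero_dimensional_in_extend:
  assumes M: "closedin W M" and N: "zero_dimensional_in W N"
    and rest: "\<And>F. closedin W F \<Longrightarrow> F \<subseteq> M \<Longrightarrow> disjnt F N \<Longrightarrow> zero_dimensional_in W F"
  shows "zero_dimensional_in W M"
  unfolding zero_dimensional_in_def
proof (intro allI impI, elim conjE)
  fix A B assume "closedin W A" "closedin W B" "disjnt A B"
  then obtain U V where UV: "openin W U" "openin W V" "A \<subseteq> U" "B \<subseteq> V" "N \<subseteq> U \<union> V"
    "disjnt (W closure_of U) (W closure_of V)"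
    using zero_dimensional_inE[OF N] by metis
  have cl: "U \<subseteq> W closure_of U" "V \<subseteq> W closure_of V"
    using UV by (auto intro!: closure_of_subset openin_subset)
  have "zero_dimensional_in W (M - (U \<union> V))"
    using UV by (intro rest closedin_diff M openin_Un) (auto simp: disjnt_def)
  then obtain U' V' where UV': "openin W U'" "openin W V'" "W closure_of U \<subseteq> U'"
    "W closure_of V \<subseteq> V'" "M - (U \<union> V) \<subseteq> U' \<union> V'" "disjnt (W closure_of U') (W closure_of V')"
    using UV by (meson closedin_closure_of zero_dimensional_inE)
  show "\<exists>U V. openin W U \<and> openin W V \<and> A \<subseteq> U \<and> B \<subseteq> V \<and> M \<subseteq> U \<union> V \<and>
      disjnt (W closure_of U) (W closure_of V)"
    by (rule exI[of _ U'], rule exI[of _ V']) (use UV UV' cl in blast)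
qed

text \<open>
  In a compact Hausdorff space two closed sets that no connected set joins are separated by a
  clopen partition (\<open>cut_wire_fence_theorem\<close>). Adding the two parts of such a partition of \<open>F\<close> to the
  given closed sets keeps them disjoint, and normality provides the neighbourhoods.
\<close>

lemma totally_disconnected_imp_zero_dimensional_in:
  assumes W: "compact_space W" "Hausdorff_space W" and F: "closedin W F"
    and conn: "\<And>C x y. connectedin W C \<Longrightarrow> C \<subseteq> F \<Longrightarrow> x \<in> C \<Longrightarrow> y \<in> C \<Longrightarrow> x = y"
  shows "zero_dimensional_in W F"
  unfolding zero_dimensional_in_def
proof (intro allI impI, elim conjE)
  fix A B assume A: "closedin W A" and B: "closedin W B" and dis: "disjnt A B"
  let ?F = "subtopology W F"
  have "compact_space ?F"
    using F W closedin_compact_space compact_space_subtopology by blast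
  have "separated_between ?F (F \<inter> A) (F \<inter> B)"
  proof (rule cut_wire_fence_theorem)
    show "compact_space ?F" by fact
    show "Hausdorff_space ?F" using W Hausdorff_space_subtopology by blast
    show "closedin ?F (F \<inter> A)" "closedin ?F (F \<inter> B)"
      using A B by (auto intro: closedin_subtopology_Int_closed)
    show "disjnt C (F \<inter> A) \<or> disjnt C (F \<inter> B)" if "connectedin ?F C" for C
      using that conn dis by (auto simp: connectedin_subtopology disjnt_iff)
  qed
  then obtain P Q where PQ: "closedin ?F P" "closedin ?F Q" "P \<union> Q = topspace ?F" "disjnt P Q"
    "F \<inter> A \<subseteq> P" "F \<inter> B \<subseteq> Q"
    unfolding separated_between_alt by blast
  have P: "closedin W P" "P \<subseteq> F" and Q: "closedin W Q" "Q \<subseteq> F"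
    using PQ(1,2) by (simp_all add: closedin_closed_subtopology[OF F])
  have cov: "F \<subseteq> P \<union> Q"
    using PQ(3) closedin_subset[OF F] by auto
  have "disjnt (A \<union> P) (B \<union> Q)"
    using PQ dis P(2) Q(2) unfolding disjnt_def by blast
  moreover have "normal_space W"
    using W compact_Hausdorff_or_regular_imp_normal_space by blast
  ultimately obtain U V where "openin W U" "openin W V" "A \<union> P \<subseteq> U" "B \<union> Q \<subseteq> V"
    "disjnt (W closure_of U) (W closure_of V)"
    using closedin_Un[OF A P(1)] closedin_Un[OF B Q(1)] unfolding normal_space_disjoint_closures by meson
  then show "\<exists>U V. openin W U \<and> openin W V \<and> A \<subseteq> U \<and> B \<subseteq> V \<and> F \<subseteq> U \<union> V \<and>
      disjnt (W closure_of U) (W closure_of V)"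
    using cov by (intro exI[of _ U] exI[of _ V]) blast
qed

text \<open>
  The countable sum theorem: the closures of the neighbourhoods obtained for \<open>M n\<close> are the closed
  sets to be separated across \<open>M (n + 1)\<close>. The unions of the two increasing sequences stay disjoint.
\<close>

lemma zero_dimensional_in_countable_Union:
  fixes M :: "nat \<Rightarrow> 'a set"
  assumes M: "\<And>n. zero_dimensional_in W (M n)"
    and A: "closedin W A" and B: "closedin W B" and dis: "disjnt A B"
  obtains U V where "openin W U" "openin W V" "A \<subseteq> U" "B \<subseteq> V" "(\<Union>n. M n) \<subseteq> U \<union> V" "disjnt U V"
proof -
  let ?good = "\<lambda>n p. openin W (fst p) \<and> openin W (snd p) \<and> A \<subseteq> fst p \<and> B \<subseteq> snd p \<and>
    M n \<subseteq> fst p \<union> snd p \<and> disjnt (W closure_of fst p) (W closure_of snd p)"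
  have "\<exists>p. \<forall>n. ?good n (p n) \<and> fst (p n) \<subseteq> fst (p (Suc n)) \<and> snd (p n) \<subseteq> snd (p (Suc n))"
  proof (rule dependent_nat_choice)
    obtain U V where "openin W U" "openin W V" "A \<subseteq> U" "B \<subseteq> V" "M 0 \<subseteq> U \<union> V"
      "disjnt (W closure_of U) (W closure_of V)"
      using zero_dimensional_inE[OF M A B dis] by metis
    then show "\<exists>p. ?good 0 p" by (intro exI[of _ "(U, V)"]) simp
  next
    fix p n assume p: "?good n p"
    obtain U V where UV: "openin W U" "openin W V" "W closure_of fst p \<subseteq> U" "W closure_of snd p \<subseteq> V"
      "M (Suc n) \<subseteq> U \<union> V" "disjnt (W closure_of U) (W closure_of V)"
      using zero_dimensional_inE[OF M closedin_closure_of closedin_closure_of] p by metis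
    moreover have "fst p \<subseteq> W closure_of fst p" "snd p \<subseteq> W closure_of snd p"
      using p by (auto intro!: closure_of_subset openin_subset)
    ultimately show "\<exists>p'. ?good (Suc n) p' \<and> fst p \<subseteq> fst p' \<and> snd p \<subseteq> snd p'"
      using p by (intro exI[of _ "(U, V)"]) auto
  qed
  then obtain p where p: "\<And>n. ?good n (p n)" and
    inc: "\<And>n. fst (p n) \<subseteq> fst (p (Suc n))" "\<And>n. snd (p n) \<subseteq> snd (p (Suc n))"
    by metis
  have mono: "mono (\<lambda>n. fst (p n))" "mono (\<lambda>n. snd (p n))"
    using inc by (auto simp: mono_iff_le_Suc)
  have "disjnt (fst (p m)) (snd (p n))" for m n
  proof -
    let ?k = "max m n"
    have "fst (p m) \<subseteq> fst (p ?k)" "snd (p n) \<subseteq> snd (p ?k)"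
      using mono[THEN monoD, of m ?k] mono[THEN monoD, of n ?k] by simp_all
    moreover have "fst (p ?k) \<subseteq> W closure_of fst (p ?k)" "snd (p ?k) \<subseteq> W closure_of snd (p ?k)"
      using p by (auto intro!: closure_of_subset openin_subset)
    ultimately show ?thesis using p[of ?k] unfolding disjnt_def by blast
  qed
  then have "disjnt (\<Union>n. fst (p n)) (\<Union>n. snd (p n))"
    by (auto simp: disjnt_iff)
  moreover have "openin W (\<Union>n. fst (p n))" "openin W (\<Union>n. snd (p n))"
    using p by auto
  moreover have "A \<subseteq> (\<Union>n. fst (p n))" "B \<subseteq> (\<Union>n. snd (p n))"
    "(\<Union>n. M n) \<subseteq> (\<Union>n. fst (p n)) \<union> (\<Union>n. snd (p n))"
    using p by blast+
  ultimately show ?thesis using that by blast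
qed

section \<open>Covering dimension zero and clopen separation\<close>

lemma zero_dimensional_iff: "zero_dimensional X \<longleftrightarrow> covering_dim_le X 0"
proof
  assume "zero_dimensional X"
  then have "(INF n\<in>{n. covering_dim_le X n}. enat n) < enat 1"
    by (simp add: zero_dimensional_def covering_dim_def one_enat_def zero_enat_def)
  then show "covering_dim_le X 0"
    by (auto simp: INF_less_iff)
next
  assume "covering_dim_le X 0"
  then have "covering_dim X \<le> enat 0"
    unfolding covering_dim_def by (intro INF_lower) simp
  then show "zero_dimensional X"
    by (simp add: zero_dimensional_def zero_enat_def[symmetric])
qed

lemma functionally_open_in_imp_openin:
  assumes "functionally_open_in X U"
  shows "openin X U"
proof -
  obtain h where h: "continuous_map X euclideanreal h" and U: "U = {x \<in> topspace X. h x \<in> - {0}}"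
    using assms by (auto simp: functionally_open_in_def)
  show ?thesis
    unfolding U by (rule openin_continuous_map_preimage[OF h]) (simp add: open_Compl)
qed

lemma clopen_indicator_continuous:
  assumes "openin X P" "closedin X P"
  shows "continuous_map X euclideanreal (indicator P)"
  unfolding continuous_map_def
proof (intro conjI allI impI)
  fix G :: "real set"
  have "{x \<in> topspace X. indicator P x \<in> G} =
      (if 1 \<in> G then P else {}) \<union> (if 0 \<in> G then topspace X - P else {})"
    using openin_subset[OF assms(1)] by (auto simp: indicator_def split: if_splits)
  also have "openin X \<dots>" using assms by auto
  finally show "openin X {x \<in> topspace X. indicator P x \<in> G}" .
qed simp

lemma clopen_imp_functionally_open_in:
  assumes "openin X P" "closedin X P"
  shows "functionally_open_in X P"
  unfolding functionally_open_in_def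
  using clopen_indicator_continuous[OF assms] openin_subset[OF assms(1)]
  by (intro exI[of _ "indicator P"]) (auto simp: indicator_def)

lemma functionally_open_in_pos:
  assumes "continuous_map X euclideanreal h"
  shows "functionally_open_in X {x \<in> topspace X. h x > 0}"
  unfolding functionally_open_in_def
  by (rule exI[of _ "\<lambda>x. max (h x) 0"]) (auto intro!: continuous_map_real_max assms)

text \<open>
  A refinement of order zero of the cover by \<open>h < b\<close> and \<open>h > a\<close> is a partition into open sets.
  The union of the members inside \<open>h < b\<close> is clopen, and the other members lie inside \<open>h > a\<close>.
\<close>

lemma covering_dim_le_0_imp_clopen_separation:
  assumes dim: "covering_dim_le X 0" and h: "continuous_map X euclideanreal h" and "a < b"
  obtains P where "openin X P" "closedin X P" "{x \<in> topspace X. h x \<le> a} \<subseteq> P"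
    "P \<subseteq> {x \<in> topspace X. h x < b}"
proof -
  let ?U = "{x \<in> topspace X. b - h x > 0}" and ?V = "{x \<in> topspace X. h x - a > 0}"
  have "functionally_open_in X ?U" "functionally_open_in X ?V"
    by (intro functionally_open_in_pos continuous_map_diff h; simp)+
  moreover have "?U \<union> ?V = topspace X"
    using \<open>a < b\<close> by auto
  ultimately have "finite_functionally_open_cover X {?U, ?V}"
    unfolding finite_functionally_open_cover_def by simp
  from dim[unfolded covering_dim_le_def, rule_format, OF this]
  obtain \<V> where "finite_functionally_open_cover X \<V> \<and> (\<forall>V\<in>\<V>. \<exists>U\<in>{?U, ?V}. V \<subseteq> U) \<and>
      (\<forall>x\<in>topspace X. card {V \<in> \<V>. x \<in> V} \<le> 0 + 1)" ..
  then have \<V>: "finite_functionally_open_cover X \<V>" "\<And>V. V \<in> \<V> \<Longrightarrow> V \<subseteq> ?U \<or> V \<subseteq> ?V"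
    and card: "\<And>x. x \<in> topspace X \<Longrightarrow> card {V \<in> \<V>. x \<in> V} \<le> 1"
    by auto
  have fin: "finite \<V>" and op: "\<And>V. V \<in> \<V> \<Longrightarrow> openin X V" and cov: "\<Union>\<V> = topspace X"
    using \<V>(1) functionally_open_in_imp_openin by (auto simp: finite_functionally_open_cover_def)
  have disj: "V = V'" if "V \<in> \<V>" "V' \<in> \<V>" "x \<in> V" "x \<in> V'" for V V' x
    using card[of x] fin that cov by (auto simp: card_le_Suc0_iff_eq)
  let ?P = "\<Union>{V \<in> \<V>. V \<subseteq> ?U}" and ?Q = "\<Union>{V \<in> \<V>. \<not> V \<subseteq> ?U}"
  have "?P = topspace X - ?Q"
    using cov disj by fast
  moreover have "openin X ?P" "openin X ?Q"
    using op by auto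
  ultimately have "closedin X ?P"
    using closedin_diff[OF closedin_topspace \<open>openin X ?Q\<close>] by simp
  moreover have "{x \<in> topspace X. h x \<le> a} \<subseteq> ?P"
  proof
    fix x assume x: "x \<in> {x \<in> topspace X. h x \<le> a}"
    then obtain V where "V \<in> \<V>" "x \<in> V" using cov by auto
    with x \<V>(2)[of V] show "x \<in> ?P" by auto
  qed
  ultimately show ?thesis
    using that[of ?P] \<open>openin X ?P\<close> by auto
qed

text \<open>
  Normalise the functions that define the \<open>n\<close> members of a cover to a partition of unity. At each
  point some value is at least \<open>1 / n\<close>, so the clopen sets that separate the points of value at least
  \<open>1 / n\<close> from the zeros form a cover. Subtracting the earlier ones makes them disjoint.
\<close>

lemma clopen_separation_imp_covering_dim_le_0:
  assumes sep: "\<And>h. bounded_continuous X h \<Longrightarrow>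
     \<exists>P. openin X P \<and> closedin X P \<and> {x \<in> topspace X. h x \<le> 0} \<subseteq> P \<and> P \<subseteq> {x \<in> topspace X. h x < 1}"
  shows "covering_dim_le X 0"
  unfolding covering_dim_le_def
proof (intro allI impI)
  fix \<U> assume \<U>: "finite_functionally_open_cover X \<U>"
  then have fin: "finite \<U>" and cov: "\<Union>\<U> = topspace X"
    by (auto simp: finite_functionally_open_cover_def)
  obtain n and U :: "nat \<Rightarrow> 'a set" where \<U>eq: "\<U> = U ` {..<n}"
    using fin by (metis finite_imp_nat_seg_image_inj_on lessThan_def)
  have "\<exists>h. continuous_map X euclideanreal h \<and> U i = {x \<in> topspace X. h x \<noteq> 0}" if "i < n" for i
    using \<U> that \<U>eq by (auto simp: finite_functionally_open_cover_def functionally_open_in_def)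
  then obtain h where h: "\<And>i. i < n \<Longrightarrow> continuous_map X euclideanreal (h i)"
    and Ui: "\<And>i. i < n \<Longrightarrow> U i = {x \<in> topspace X. h i x \<noteq> 0}"
    by metis
  define s where "s x = (\<Sum>j<n. \<bar>h j x\<bar>)" for x
  have spos: "s x > 0" if x: "x \<in> topspace X" for x
  proof -
    obtain i where i: "i < n" "x \<in> U i"
      using cov x unfolding \<U>eq by blast
    then have "h i x \<noteq> 0" by (simp add: Ui)
    then have "0 < \<bar>h i x\<bar>" by simp
    also have "\<dots> \<le> s x" unfolding s_def using i by (intro member_le_sum) auto
    finally show ?thesis .
  qed
  have scont: "continuous_map X euclideanreal s"
    unfolding s_def by (intro continuous_map_sum continuous_map_real_abs h) auto
  \<comment> \<open>The set \<open>u i \<le> 0\<close> is where the \<open>i\<close>-th function of the partition of unity is at least \<open>1 / n\<close>.\<close>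
  define u where "u i x = 1 - real n * (\<bar>h i x\<bar> / s x)" for i x
  have "\<exists>P. openin X P \<and> closedin X P \<and> {x \<in> topspace X. u i x \<le> 0} \<subseteq> P \<and> P \<subseteq> U i" if i: "i < n" for i
  proof -
    have "continuous_map X euclideanreal (u i)"
      unfolding u_def using spos
      by (intro continuous_intros continuous_map_real_divide continuous_map_real_mult continuous_map_diff continuous_map_real_abs h i scont) force+
    moreover have "\<bar>u i x\<bar> \<le> 1 + real n" if x: "x \<in> topspace X" for x
    proof -
      have "\<bar>h i x\<bar> \<le> s x" unfolding s_def using i by (intro member_le_sum) auto
      then have "0 \<le> \<bar>h i x\<bar> / s x" "\<bar>h i x\<bar> / s x \<le> 1" using spos[OF x] by auto
      then have "0 \<le> real n * (\<bar>h i x\<bar> / s x)" "real n * (\<bar>h i x\<bar> / s x) \<le> real n * 1"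
        by (auto intro!: mult_left_mono simp del: times_divide_eq_right mult_1_right)
      then show ?thesis unfolding u_def by linarith
    qed
    ultimately have "bounded_continuous X (u i)" by (rule bounded_continuousI)
    from sep[OF this] obtain Q where Q: "openin X Q" "closedin X Q"
      "{x \<in> topspace X. u i x \<le> 0} \<subseteq> Q" "Q \<subseteq> {x \<in> topspace X. u i x < 1}"
      by blast
    have "{x \<in> topspace X. u i x < 1} \<subseteq> U i"
      by (auto simp: Ui[OF i] u_def)
    with Q show ?thesis by blast
  qed
  then have "\<exists>P. \<forall>i<n. openin X (P i) \<and> closedin X (P i) \<and>
      {x \<in> topspace X. u i x \<le> 0} \<subseteq> P i \<and> P i \<subseteq> U i"
    by metis
  then obtain P where Pc: "\<And>i. i < n \<Longrightarrow> openin X (P i)" "\<And>i. i < n \<Longrightarrow> closedin X (P i)"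
    and Pu: "\<And>i x. i < n \<Longrightarrow> x \<in> topspace X \<Longrightarrow> u i x \<le> 0 \<Longrightarrow> x \<in> P i"
    and PU: "\<And>i. i < n \<Longrightarrow> P i \<subseteq> U i"
    by blast
  have Pcov: "\<exists>i<n. x \<in> P i" if x: "x \<in> topspace X" for x
  proof (rule ccontr)
    \<comment> \<open>At an uncovered point all \<open>u i\<close> would be positive, but they sum up to \<open>n - n = 0\<close>.\<close>
    assume "\<not> (\<exists>i<n. x \<in> P i)"
    then have *: "0 < u i x" if "i < n" for i
      using Pu[OF that x] that by force
    have "n > 0" using spos[OF x] by (cases n) (auto simp: s_def)
    then have "0 < (\<Sum>i<n. u i x)" using * by (intro sum_pos) auto
    also have "\<dots> = real n - real n * (\<Sum>i<n. \<bar>h i x\<bar> / s x)"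
      unfolding u_def sum_subtractf sum_distrib_left by simp
    also have "(\<Sum>i<n. \<bar>h i x\<bar> / s x) = 1"
      using spos[OF x] by (simp add: s_def flip: sum_divide_distrib)
    finally show False by simp
  qed
  let ?D = "\<lambda>i. P i - (\<Union>j<i. P j)"
  have Dc: "openin X (?D i)" "closedin X (?D i)" if "i < n" for i
    using that Pc by (auto intro!: openin_diff closedin_diff closedin_Union)
  have "finite_functionally_open_cover X (?D ` {..<n})"
    unfolding finite_functionally_open_cover_def
  proof (intro conjI ballI)
    show "functionally_open_in X V" if "V \<in> ?D ` {..<n}" for V
      using that Dc clopen_imp_functionally_open_in by auto
    show "\<Union> (?D ` {..<n}) = topspace X"
    proof
      show "\<Union> (?D ` {..<n}) \<subseteq> topspace X" using Pc openin_subset by fast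
      show "topspace X \<subseteq> \<Union> (?D ` {..<n})"
      proof
        fix x assume x: "x \<in> topspace X"
        let ?i = "LEAST i. x \<in> P i"
        obtain j where j: "j < n" "x \<in> P j" using Pcov[OF x] by auto
        have "?i < n" using Least_le[of "\<lambda>i. x \<in> P i", OF j(2)] j by simp
        moreover have "x \<in> ?D ?i"
          using LeastI[of "\<lambda>i. x \<in> P i", OF j(2)] not_less_Least by blast
        ultimately show "x \<in> \<Union> (?D ` {..<n})" by blast
      qed
    qed
  qed simp
  moreover have "\<forall>V\<in>?D ` {..<n}. \<exists>U\<in>\<U>. V \<subseteq> U"
  proof
    fix V assume "V \<in> ?D ` {..<n}"
    then obtain i where i: "i < n" "V = ?D i" by blast
    then have "V \<subseteq> U i" "U i \<in> \<U>" using PU[of i] \<U>eq by auto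
    then show "\<exists>U\<in>\<U>. V \<subseteq> U" ..
  qed
  moreover have "\<forall>x\<in>topspace X. card {V \<in> ?D ` {..<n}. x \<in> V} \<le> 0 + 1"
  proof
    fix x assume "x \<in> topspace X"
    have "i = j" if "x \<in> ?D i" "x \<in> ?D j" for i j
      using that by (cases i j rule: linorder_cases) auto
    then have "\<forall>V\<in>{V \<in> ?D ` {..<n}. x \<in> V}. \<forall>V'\<in>{V \<in> ?D ` {..<n}. x \<in> V}. V = V'"
      by blast
    moreover have "finite {V \<in> ?D ` {..<n}. x \<in> V}" by simp
    ultimately have "card {V \<in> ?D ` {..<n}. x \<in> V} \<le> Suc 0"
      using card_le_Suc0_iff_eq by blast
    then show "card {V \<in> ?D ` {..<n}. x \<in> V} \<le> 0 + 1" by simp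
  qed
  ultimately show "\<exists>\<V>. finite_functionally_open_cover X \<V> \<and> (\<forall>V\<in>\<V>. \<exists>U\<in>\<U>. V \<subseteq> U) \<and>
      (\<forall>x\<in>topspace X. card {V \<in> \<V>. x \<in> V} \<le> 0 + 1)"
    by blast
qed

section \<open>Finite supports in the compactification\<close>

text \<open>
  The part by which \<open>a\<close> exceeds \<open>q\<close>, cut off at \<open>1\<close>. The functions \<open>S f\<close> may be unbounded and
  then have no real-valued extension to the compactification. The bounded function
  \<open>excess q \<bar>S f - S g\<bar>\<close> has one, and it vanishes at \<open>w\<close> exactly if \<open>\<bar>S f - S g\<bar> \<le> q\<close> at \<open>w\<close> in the
  limit sense.
\<close>

definition excess :: "real \<Rightarrow> real \<Rightarrow> real" where
  "excess q a = max 0 (min (a - q) 1)"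

lemma excess_add: "excess (s + t) (a + b) \<le> excess s a + excess t b"
  by (simp add: excess_def max_def min_def)

lemma excess_mono: "a \<le> b \<Longrightarrow> excess q a \<le> excess q b"
  by (auto simp: excess_def max_def min_def)

lemma excess_bounds: "0 \<le> excess q a" "excess q a \<le> 1"
  by (auto simp: excess_def)

text \<open>
  What remains of a \<open>c\<close>-good uniformly continuous map once its arguments are functions on a
  compactification \<open>Z\<close> of \<open>X\<close>. Uniform continuity enters only at single points of \<open>Y\<close>.
\<close>

locale good_operator =
  fixes Z :: "'z topology" and Y :: "'b topology"
    and S :: "('z \<Rightarrow> real) \<Rightarrow> 'b \<Rightarrow> real" and c :: real
  assumes compact_Z: "compact_space Z" and Hausdorff_Z: "Hausdorff_space Z"
    and Z_nonempty: "topspace Z \<noteq> {}"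
    and clopen_separated: "\<And>x z. x \<in> topspace Z \<Longrightarrow> z \<in> topspace Z \<Longrightarrow> x \<noteq> z \<Longrightarrow>
      \<exists>P. openin Z P \<and> closedin Z P \<and> x \<in> P \<and> z \<notin> P"
    and continuous_S: "\<And>f. continuous_map Z euclideanreal f \<Longrightarrow> continuous_map Y euclideanreal (S f)"
    and finitely_determined: "\<And>y. y \<in> topspace Y \<Longrightarrow> \<exists>K \<epsilon>. finite K \<and> K \<subseteq> topspace Z \<and> \<epsilon> > 0 \<and>
      (\<forall>f g. continuous_map Z euclideanreal f \<longrightarrow> continuous_map Z euclideanreal g \<longrightarrow>
         (\<forall>x\<in>K. \<bar>f x - g x\<bar> < \<epsilon>) \<longrightarrow> \<bar>S f y - S g y\<bar> < 1)"
    and good_preimage: "\<And>g r. continuous_map Y euclideanreal g \<Longrightarrow> (\<And>y. y \<in> topspace Y \<Longrightarrow> \<bar>g y\<bar> \<le> r) \<Longrightarrow>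
      \<exists>f. continuous_map Z euclideanreal f \<and> (\<forall>x\<in>topspace Z. \<bar>f x\<bar> \<le> c * r) \<and> (\<forall>y\<in>topspace Y. S f y = g y)"
begin

abbreviation "W \<equiv> stone_cech Y"

definition defect :: "real \<Rightarrow> ('z \<Rightarrow> real) \<Rightarrow> ('z \<Rightarrow> real) \<Rightarrow> 'b \<Rightarrow> real" where
  "defect q f g y = excess q \<bar>S f y - S g y\<bar>"

definition supports :: "real \<Rightarrow> (('b \<Rightarrow> real) \<Rightarrow> real) \<Rightarrow> 'z set \<Rightarrow> bool" where
  "supports q w K \<longleftrightarrow>
     (\<forall>f g. continuous_map Z euclideanreal f \<longrightarrow> continuous_map Z euclideanreal g \<longrightarrow>
        (\<forall>x\<in>K. \<bar>f x - g x\<bar> < 1) \<longrightarrow> sc_extension Y (defect q f g) w \<le> 0)"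

definition supported :: "nat \<Rightarrow> real \<Rightarrow> (('b \<Rightarrow> real) \<Rightarrow> real) set" where
  "supported p q = {w \<in> topspace W. \<exists>K\<subseteq>topspace Z. finite K \<and> card K \<le> p \<and> supports q w K}"

lemma defect_bounded_continuous:
  assumes "continuous_map Z euclideanreal f" "continuous_map Z euclideanreal g"
  shows "bounded_continuous Y (defect q f g)"
proof (rule bounded_continuousI)
  show "continuous_map Y euclideanreal (defect q f g)"
    unfolding defect_def excess_def
    by (intro continuous_map_real_max continuous_map_real_min continuous_map_diff
        continuous_map_real_abs continuous_S assms continuous_map_const[THEN iffD2]) auto
  show "\<bar>defect q f g y\<bar> \<le> 1" for y
    using excess_bounds[of q] by (simp add: defect_def)
qed

lemma continuous_defect_extension:
  assumes "continuous_map Z euclideanreal f" "continuous_map Z euclideanreal g"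
  shows "continuous_map W euclideanreal (sc_extension Y (defect q f g))"
  by (intro continuous_sc_extension defect_bounded_continuous assms)

lemma supports_mono: "supports q w K \<Longrightarrow> K \<subseteq> L \<Longrightarrow> supports q w L"
  unfolding supports_def by blast

text \<open>
  Given \<open>f\<close> and \<open>g\<close> that are close on \<open>K \<inter> L\<close>, Urysohn's lemma provides a function \<open>h\<close> that agrees
  with \<open>f\<close> on \<open>K\<close> and with \<open>g\<close> on \<open>L - K\<close>. It is close to \<open>f\<close> on \<open>K\<close> and close to \<open>g\<close> on \<open>L\<close>, so
  the passage from \<open>S f\<close> to \<open>S h\<close> costs at most \<open>q\<close> and the one from \<open>S h\<close> to \<open>S g\<close> at most \<open>r\<close>.
\<close>

lemma supports_Int:
  assumes w: "w \<in> topspace W" and K: "finite K" "K \<subseteq> topspace Z" "supports q w K"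
    and L: "finite L" "L \<subseteq> topspace Z" "supports r w L"
  shows "supports (q + r) w (K \<inter> L)"
  unfolding supports_def
proof (intro allI impI)
  fix f g assume f: "continuous_map Z euclideanreal f" and g: "continuous_map Z euclideanreal g"
    and fg: "\<forall>x\<in>K \<inter> L. \<bar>f x - g x\<bar> < 1"
  have "normal_space Z"
    using compact_Hausdorff_or_regular_imp_normal_space compact_Z Hausdorff_Z by blast
  moreover have "closedin Z K" "closedin Z (L - K)"
    using K L Hausdorff_Z by (auto intro!: closedin_Hausdorff_finite)
  moreover have "disjnt K (L - K)" by (auto simp: disjnt_def)
  ultimately obtain \<phi> where \<phi>: "continuous_map Z euclideanreal \<phi>" "\<phi> ` K \<subseteq> {1}" "\<phi> ` (L - K) \<subseteq> {0}"
    using Urysohn_lemma_alt by metis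
  define h where "h x = \<phi> x * f x + (1 - \<phi> x) * g x" for x
  have h: "continuous_map Z euclideanreal h"
    unfolding h_def by (intro continuous_map_add continuous_map_real_mult continuous_map_diff f g \<phi>(1)
        continuous_map_const[THEN iffD2]) auto
  have hK: "h x = f x" if "x \<in> K" for x
    using \<phi>(2) that by (auto simp: h_def image_subset_iff)
  have hL: "h x = g x" if "x \<in> L - K" for x
    using \<phi>(3) that by (auto simp: h_def image_subset_iff)
  have "sc_extension Y (defect q f h) w \<le> 0"
    using K(3) f h hK unfolding supports_def by simp
  moreover have "\<bar>h x - g x\<bar> < 1" if "x \<in> L" for x
    using fg hK hL that by (cases "x \<in> K") auto
  then have "sc_extension Y (defect r h g) w \<le> 0"
    using L(3) g h unfolding supports_def by simp
  moreover have "sc_extension Y (defect (q + r) f g) w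
      \<le> sc_extension Y (defect q f h) w + sc_extension Y (defect r h g) w"
  proof (rule sc_extension_le[OF defect_bounded_continuous[OF f g] _ _ w])
    show "continuous_map W euclideanreal
        (\<lambda>w. sc_extension Y (defect q f h) w + sc_extension Y (defect r h g) w)"
      by (intro continuous_map_add continuous_defect_extension f g h)
    fix y assume y: "y \<in> topspace Y"
    have "excess (q + r) \<bar>S f y - S g y\<bar> \<le> excess (q + r) (\<bar>S f y - S h y\<bar> + \<bar>S h y - S g y\<bar>)"
      by (intro excess_mono) simp
    also have "\<dots> \<le> excess q \<bar>S f y - S h y\<bar> + excess r \<bar>S h y - S g y\<bar>"
      by (rule excess_add)
    finally show "defect (q + r) f g y \<le> sc_extension Y (defect q f h) (evaluation_at Y y)
        + sc_extension Y (defect r h g) (evaluation_at Y y)"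
      using y f g h by (simp add: sc_extension_evaluation_at defect_bounded_continuous) (simp add: defect_def)
  qed
  ultimately show "sc_extension Y (defect (q + r) f g) w \<le> 0" by linarith
qed

text \<open>
  Finite sets are parametrised by tuples so that they form a compact space. For a fixed pair \<open>f, g\<close>
  the condition on \<open>(w, k)\<close> is a disjunction of closed conditions, because \<open>\<bar>f - g\<bar> < 1\<close> is
  strict in the premise and \<open>\<le> 0\<close> is not strict in the conclusion.
\<close>

lemma closedin_supports_graph:
  fixes p :: nat
  shows "closedin (prod_topology W (product_topology (\<lambda>_. Z) {..<p}))
     {(w, k). w \<in> topspace W \<and> k \<in> {..<p} \<rightarrow>\<^sub>E topspace Z \<and> supports q w (k ` {..<p})}"
    (is "closedin ?T ?G")
proof -
  let ?C = "{(f, g). continuous_map Z euclideanreal f \<and> continuous_map Z euclideanreal g}"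
  define H where "H = (\<lambda>(f, g).
    {v \<in> topspace ?T. sc_extension Y (defect q f g) (fst v) \<in> {..0}}
      \<union> (\<Union>i<p. {v \<in> topspace ?T. \<bar>f (snd v i) - g (snd v i)\<bar> \<in> {1..}}))"
  have "closedin ?T (H fg)" if "fg \<in> ?C" for fg
  proof -
    obtain f g where fg: "fg = (f, g)" and f: "continuous_map Z euclideanreal f"
      and g: "continuous_map Z euclideanreal g" using \<open>fg \<in> ?C\<close> by auto
    have "continuous_map ?T euclideanreal (\<lambda>v. sc_extension Y (defect q f g) (fst v))"
      using continuous_map_compose[OF continuous_map_fst continuous_defect_extension[OF f g]]
      by (simp add: o_def)
    then have "closedin ?T {v \<in> topspace ?T. sc_extension Y (defect q f g) (fst v) \<in> {..0}}"
      by (rule closedin_continuous_map_preimage) simp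
    moreover have "closedin ?T {v \<in> topspace ?T. \<bar>f (snd v i) - g (snd v i)\<bar> \<in> {1..}}" if "i < p" for i
    proof -
      have "continuous_map ?T Z (\<lambda>v. snd v i)"
        using continuous_map_compose[OF continuous_map_snd continuous_map_product_projection, of i "{..<p}" W "\<lambda>_. Z"] that
        by (simp add: o_def)
      then have "continuous_map ?T euclideanreal (\<lambda>v. f (snd v i))" "continuous_map ?T euclideanreal (\<lambda>v. g (snd v i))"
        using f g continuous_map_compose[of ?T Z "\<lambda>v. snd v i" euclideanreal] by (auto simp: o_def)
      then have "continuous_map ?T euclideanreal (\<lambda>v. \<bar>f (snd v i) - g (snd v i)\<bar>)"
        by (intro continuous_map_real_abs continuous_map_diff)
      then show ?thesis
        by (rule closedin_continuous_map_preimage) simp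
    qed
    ultimately show ?thesis
      unfolding fg H_def prod.case by (intro closedin_Un closedin_Union) auto
  qed
  moreover have "(\<lambda>_. 0, \<lambda>_. 0) \<in> ?C" by simp
  then have "?C \<noteq> {}" by blast
  ultimately have "closedin ?T (\<Inter>(H ` ?C))"
    by (intro closedin_Inter) auto
  also have "\<Inter>(H ` ?C) = ?G"
  proof
    show "\<Inter>(H ` ?C) \<subseteq> ?G"
    proof
      fix v assume v: "v \<in> \<Inter>(H ` ?C)"
      obtain w k where wk: "v = (w, k)" by (cases v)
      have "(\<lambda>_. 0, \<lambda>_. 0) \<in> ?C" by simp
      with v have "v \<in> H (\<lambda>_. 0, \<lambda>_. 0)" by blast
      then have "w \<in> topspace W" "k \<in> {..<p} \<rightarrow>\<^sub>E topspace Z"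
        unfolding H_def wk by auto
      moreover have "supports q w (k ` {..<p})"
        unfolding supports_def
      proof (intro allI impI)
        fix f g assume *: "continuous_map Z euclideanreal f" "continuous_map Z euclideanreal g"
          "\<forall>x\<in>k ` {..<p}. \<bar>f x - g x\<bar> < 1"
        then have "v \<in> H (f, g)" using v by blast
        with *(3) show "sc_extension Y (defect q f g) w \<le> 0"
          unfolding H_def wk by force
      qed
      ultimately show "v \<in> ?G" by (simp add: wk)
    qed
    show "?G \<subseteq> \<Inter>(H ` ?C)"
      unfolding H_def supports_def by (force simp: not_le)
  qed
  finally show ?thesis .
qed

text \<open>
  The projection along the compact space of tuples is a closed map.
\<close>

lemma closedin_supported_with:
  fixes p :: nat
  assumes "closedin (product_topology (\<lambda>_. Z) {..<p}) E"
  shows "closedin W {w \<in> topspace W. \<exists>k\<in>E. supports q w (k ` {..<p})}"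
proof -
  let ?P = "product_topology (\<lambda>_. Z) {..<p}"
  let ?G = "{(w, k). w \<in> topspace W \<and> k \<in> {..<p} \<rightarrow>\<^sub>E topspace Z \<and> supports q w (k ` {..<p})}"
  have "compact_space ?P"
    using compact_Z by (simp add: compact_space_product_topology)
  then have "closed_map (prod_topology W ?P) W fst"
    by (rule closed_map_fst)
  moreover have "closedin (prod_topology W ?P) (?G \<inter> (topspace W \<times> E))"
    by (intro closedin_Int closedin_supports_graph) (simp add: closedin_prod_Times_iff assms)
  ultimately have "closedin W (fst ` (?G \<inter> (topspace W \<times> E)))"
    by (simp add: closed_map_def)
  also have "fst ` (?G \<inter> (topspace W \<times> E)) = {w \<in> topspace W. \<exists>k\<in>E. supports q w (k ` {..<p})}"
  proof (intro equalityI subsetI)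
    fix w assume "w \<in> {w \<in> topspace W. \<exists>k\<in>E. supports q w (k ` {..<p})}"
    then obtain k where "w \<in> topspace W" "k \<in> E" "supports q w (k ` {..<p})" by blast
    moreover have "k \<in> {..<p} \<rightarrow>\<^sub>E topspace Z"
      using closedin_subset[OF assms] \<open>k \<in> E\<close> by auto
    ultimately have "(w, k) \<in> ?G \<inter> (topspace W \<times> E)" by simp
    then show "w \<in> fst ` (?G \<inter> (topspace W \<times> E))"
      by (rule image_eqI[rotated]) simp
  next
    fix w assume "w \<in> fst ` (?G \<inter> (topspace W \<times> E))"
    then obtain v where "v \<in> ?G" "v \<in> topspace W \<times> E" "w = fst v" by blast
    then show "w \<in> {w \<in> topspace W. \<exists>k\<in>E. supports q w (k ` {..<p})}"
      by (cases v) auto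
  qed
  finally show ?thesis .
qed

lemma finite_set_in_tuple:
  assumes "finite K" "K \<subseteq> topspace Z" "card K \<le> p"
  obtains k where "k \<in> {..<p} \<rightarrow>\<^sub>E topspace Z" "K \<subseteq> k ` {..<p}"
proof -
  obtain z where z: "z \<in> topspace Z" using Z_nonempty by blast
  obtain h where h: "bij_betw h {..<card K} K"
    using ex_bij_betw_nat_finite[OF \<open>finite K\<close>] by (metis atLeast0LessThan)
  let ?k = "\<lambda>i\<in>{..<p}. if i < card K then h i else z"
  have hK: "h ` {..<card K} = K" using h by (simp add: bij_betw_def)
  have hZ: "h i \<in> topspace Z" if "i < card K" for i
    using hK that assms(2) by blast
  show ?thesis
  proof (rule that[of ?k])
    show "?k \<in> {..<p} \<rightarrow>\<^sub>E topspace Z"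
      using hZ z by auto
    show "K \<subseteq> ?k ` {..<p}"
    proof
      fix x assume "x \<in> K"
      then obtain i where "i < card K" "x = h i" using hK by blast
      then show "x \<in> ?k ` {..<p}" using assms(3) by (intro image_eqI[of _ _ i]) auto
    qed
  qed
qed

lemma supported_iff_tuple:
  "supported p q = {w \<in> topspace W. \<exists>k\<in>{..<p} \<rightarrow>\<^sub>E topspace Z. supports q w (k ` {..<p})}"
proof (intro equalityI subsetI)
  fix w assume "w \<in> supported p q"
  then obtain K where w: "w \<in> topspace W" and K: "K \<subseteq> topspace Z" "finite K" "card K \<le> p" "supports q w K"
    by (auto simp: supported_def)
  from finite_set_in_tuple[OF K(2,1,3)] obtain k where "k \<in> {..<p} \<rightarrow>\<^sub>E topspace Z" "K \<subseteq> k ` {..<p}" .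
  then show "w \<in> {w \<in> topspace W. \<exists>k\<in>{..<p} \<rightarrow>\<^sub>E topspace Z. supports q w (k ` {..<p})}"
    using w K(4) supports_mono by blast
next
  fix w assume "w \<in> {w \<in> topspace W. \<exists>k\<in>{..<p} \<rightarrow>\<^sub>E topspace Z. supports q w (k ` {..<p})}"
  then obtain k where k: "w \<in> topspace W" "k \<in> {..<p} \<rightarrow>\<^sub>E topspace Z" "supports q w (k ` {..<p})"
    by blast
  moreover have "card (k ` {..<p}) \<le> p" using card_image_le[of "{..<p}" k] by simp
  ultimately show "w \<in> supported p q"
    unfolding supported_def by (auto intro!: exI[of _ "k ` {..<p}"])
qed

lemma closedin_supported: "closedin W (supported p q)"
proof -
  have "closedin (product_topology (\<lambda>_. Z) {..<p}) ({..<p} \<rightarrow>\<^sub>E topspace Z)"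
    using closedin_topspace[of "product_topology (\<lambda>_. Z) {..<p}"] by simp
  from closedin_supported_with[OF this] show ?thesis
    by (simp add: supported_iff_tuple)
qed

text \<open>
  If \<open>\<bar>f - g\<bar> < 1\<close> on \<open>K\<close>, then \<open>f\<close> and \<open>g\<close> are joined by \<open>N > 1 / \<epsilon>\<close> steps of size less than \<open>\<epsilon>\<close>
  on \<open>K\<close>, each of which changes the value of \<open>S\<close> at \<open>y\<close> by less than \<open>1\<close>.
\<close>

lemma point_supported:
  assumes y: "y \<in> topspace Y"
  shows "\<exists>p n. evaluation_at Y y \<in> supported p (real n)"
proof -
  obtain K \<epsilon> where K: "finite K" "K \<subseteq> topspace Z" and "\<epsilon> > 0" and
    det: "\<And>f g. continuous_map Z euclideanreal f \<Longrightarrow> continuous_map Z euclideanreal g \<Longrightarrow>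
         (\<And>x. x\<in>K \<Longrightarrow> \<bar>f x - g x\<bar> < \<epsilon>) \<Longrightarrow> \<bar>S f y - S g y\<bar> < 1"
    using finitely_determined[OF y] by metis
  obtain N :: nat where N: "N > 0" "1 / real N < \<epsilon>"
    using \<open>\<epsilon> > 0\<close> by (metis real_arch_inverse inverse_eq_divide zero_less_iff_neq_zero)
  have "supports (real N) (evaluation_at Y y) K"
    unfolding supports_def
  proof (intro allI impI)
    fix f g assume f: "continuous_map Z euclideanreal f" and g: "continuous_map Z euclideanreal g"
      and fg: "\<forall>x\<in>K. \<bar>f x - g x\<bar> < 1"
    define h where "h i x = f x + (real i / real N) * (g x - f x)" for i :: nat and x
    have h: "continuous_map Z euclideanreal (h i)" for i
      unfolding h_def by (intro continuous_map_add continuous_map_real_mult continuous_map_diff f g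
        continuous_map_const[THEN iffD2]) auto
    have step: "\<bar>S (h i) y - S (h (Suc i)) y\<bar> < 1" for i
    proof (rule det[OF h h])
      fix x assume "x \<in> K"
      have "h i x - h (Suc i) x = (f x - g x) / real N"
        using N by (simp add: h_def field_simps)
      then have "\<bar>h i x - h (Suc i) x\<bar> = \<bar>f x - g x\<bar> / real N"
        by simp
      also have "\<dots> \<le> 1 / real N"
        using fg \<open>x \<in> K\<close> by (intro divide_right_mono) force+
      finally show "\<bar>h i x - h (Suc i) x\<bar> < \<epsilon>" using N by simp
    qed
    have "\<bar>S (h 0) y - S (h i) y\<bar> \<le> real i" for i
    proof (induction i)
      case (Suc i) then show ?case using step[of i] by simp
    qed simp
    moreover have "h 0 = f" "h N = g"
      using N by (auto simp: h_def)
    ultimately have "\<bar>S f y - S g y\<bar> \<le> real N" by metis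
    then show "sc_extension Y (defect (real N) f g) (evaluation_at Y y) \<le> 0"
      by (simp add: sc_extension_evaluation_at defect_bounded_continuous f g y) (simp add: defect_def excess_def)
  qed
  then have "evaluation_at Y y \<in> supported (card K) (real N)"
    using K evaluation_at_in_stone_cech[OF y] by (auto simp: supported_def)
  then show ?thesis by blast
qed

section \<open>Continua in the supported sets\<close>

text \<open>
  A continuous function \<open>u\<close> with different values at \<open>v\<close> and \<open>w\<close> maps \<open>C\<close> onto a set that contains
  an interval \<open>{a..b}\<close>. The functions \<open>\<beta> n \<circ> u\<close>, where \<open>\<beta> n\<close> rises from \<open>0\<close> to \<open>R\<close> on an
  initial part of relative length \<open>1 / 2 ^ n\<close> of the interval, are bounded by \<open>R\<close> and pairwise
  at distance at least \<open>R / 2 > q\<close> at some point of \<open>C\<close>. Their preimages under \<open>S\<close> are bounded by \<open>c * R\<close>, so two of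
  them have the same integer parts on the finite set \<open>K\<close> and thus differ there by less than \<open>1\<close>,
  which contradicts that \<open>K\<close> supports the points of \<open>C\<close>.
\<close>

lemma connected_common_support_trivial:
  assumes q: "q \<ge> 0" and C: "connectedin W C" and K: "finite K" "K \<subseteq> topspace Z"
    and supp: "\<And>w. w \<in> C \<Longrightarrow> supports q w K" and v: "v \<in> C" and w: "w \<in> C"
  shows "v = w"
proof (rule ccontr)
  assume "v \<noteq> w"
  have CW: "C \<subseteq> topspace W" using C connectedin_subset_topspace by blast
  with \<open>v \<noteq> w\<close> v w obtain u where u: "bounded_continuous Y u"
    and less: "sc_extension Y u v < sc_extension Y u w"
    using stone_cech_separated by (metis subsetD)
  define a b where "a = sc_extension Y u v" and "b = sc_extension Y u w"
  have "a < b" using less by (simp add: a_def b_def)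
  have conn: "connected (sc_extension Y u ` C)"
    using connectedin_continuous_map_image[OF continuous_sc_extension[OF u] C] by (simp add: connectedin_iff_connected)
  \<comment> \<open>The factor \<open>2\<close> makes \<open>R / 2\<close> exceed \<open>q\<close> by \<open>1\<close>, the value at which the excess is cut off.\<close>
  define R where "R = 2 * (q + 1)"
  have "R > 0" using q by (simp add: R_def)
  define \<beta> where "\<beta> n t = R * max 0 (min 1 (2 ^ n * ((t - a) / (b - a))))" for n :: nat and t :: real
  have \<beta>_bounds: "0 \<le> \<beta> n t" "\<beta> n t \<le> R" for n t
    using \<open>R > 0\<close> by (auto simp: \<beta>_def mult_le_cancel_left1 max_def min_def)
  have \<beta>_cont: "continuous_map T euclideanreal (\<lambda>x. \<beta> n (h x))"
    if "continuous_map T euclideanreal h" for n h and T :: "'c topology"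
    unfolding \<beta>_def
    using \<open>a < b\<close> that
    by (intro continuous_map_real_mult continuous_map_real_max continuous_map_real_min
        continuous_map_real_divide continuous_map_diff) auto
  have ucont: "continuous_map Y euclideanreal u" using u by (simp add: bounded_continuous_def)
  have "\<exists>f. continuous_map Z euclideanreal f \<and> (\<forall>x\<in>topspace Z. \<bar>f x\<bar> \<le> c * R) \<and>
      (\<forall>y\<in>topspace Y. S f y = \<beta> n (u y))" for n
    by (rule good_preimage[OF \<beta>_cont[OF ucont]]) (use \<beta>_bounds in auto)
  then obtain f where f: "\<And>n. continuous_map Z euclideanreal (f n)"
    and fb: "\<And>n x. x \<in> topspace Z \<Longrightarrow> \<bar>f n x\<bar> \<le> c * R"
    and Sf: "\<And>n y. y \<in> topspace Y \<Longrightarrow> S (f n) y = \<beta> n (u y)"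
    by metis
  define code where "code n = (\<lambda>x\<in>K. \<lfloor>f n x\<rfloor>)" for n
  have "- (c * R) \<le> f n x \<and> f n x \<le> c * R" if "x \<in> K" for n x
    using fb[of x n] K(2) that by (simp add: abs_le_iff subset_iff)
  then have "code n \<in> K \<rightarrow>\<^sub>E {\<lfloor>- (c * R)\<rfloor>..\<lfloor>c * R\<rfloor>}" for n
    by (auto simp: code_def intro!: floor_mono)
  then have "finite (range code)"
    using K(1) by (intro finite_subset[of "range code" "K \<rightarrow>\<^sub>E {\<lfloor>- (c * R)\<rfloor>..\<lfloor>c * R\<rfloor>}"])
      (auto intro!: finite_PiE)
  then have "\<not> inj code"
    using finite_imageD infinite_UNIV_nat by blast
  then obtain m n where mn: "m < n" "code m = code n"
    by (metis injI linorder_neqE_nat)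
  have close: "\<bar>f m x - f n x\<bar> < 1" if "x \<in> K" for x
  proof -
    have "\<lfloor>f m x\<rfloor> = \<lfloor>f n x\<rfloor>"
      using fun_cong[OF mn(2), of x] that by (simp add: code_def)
    then show ?thesis by linarith
  qed
  \<comment> \<open>At \<open>t\<close> the function \<open>\<beta> n\<close> has just reached \<open>R\<close> and the flatter \<open>\<beta> m\<close> is at most \<open>R / 2\<close>.\<close>
  define t where "t = a + (b - a) / 2 ^ n"
  have "(b - a) / 2 ^ n \<le> (b - a) / 1"
    using \<open>a < b\<close> by (intro divide_left_mono) auto
  then have "a \<le> t" "t \<le> b"
    using \<open>a < b\<close> by (simp_all add: t_def)
  then have "t \<in> sc_extension Y u ` C"
    using conn v w unfolding connected_iff_interval a_def b_def by blast
  then obtain z where z: "z \<in> C" "sc_extension Y u z = t" by blast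
  have "sc_extension Y (defect q (f m) (f n)) z = excess q \<bar>\<beta> m t - \<beta> n t\<bar>"
    unfolding z(2)[symmetric]
  proof (rule sc_extension_unique[OF defect_bounded_continuous[OF f f]])
    show "z \<in> topspace W" using z CW by blast
    show "continuous_map W euclideanreal
        (\<lambda>z. excess q \<bar>\<beta> m (sc_extension Y u z) - \<beta> n (sc_extension Y u z)\<bar>)"
      unfolding excess_def
      by (intro continuous_map_real_max continuous_map_real_min continuous_map_diff
        continuous_map_real_abs \<beta>_cont continuous_sc_extension u continuous_map_const[THEN iffD2]) auto
    show "excess q \<bar>\<beta> m (sc_extension Y u (evaluation_at Y y)) - \<beta> n (sc_extension Y u (evaluation_at Y y))\<bar>
        = defect q (f m) (f n) y" if "y \<in> topspace Y" for y
      using that by (simp add: sc_extension_evaluation_at u defect_def Sf)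
  qed
  moreover have "\<beta> n t = R"
    using \<open>a < b\<close> by (simp add: \<beta>_def t_def)
  moreover have "\<beta> m t \<le> R / 2"
  proof -
    have "(2::real) ^ m * 2 \<le> 2 ^ n"
      using power_increasing[of "Suc m" n "2::real"] mn(1) by simp
    then have "2 ^ m * ((t - a) / (b - a)) \<le> 1 / 2"
      using \<open>a < b\<close> by (simp add: t_def divide_simps)
    then have "max 0 (min 1 (2 ^ m * ((t - a) / (b - a)))) \<le> 1 / 2"
      by (simp only: max.bounded_iff min_le_iff_disj) simp
    then have "R * max 0 (min 1 (2 ^ m * ((t - a) / (b - a)))) \<le> R * (1 / 2)"
      using \<open>R > 0\<close> by (intro mult_left_mono) auto
    then show ?thesis by (simp add: \<beta>_def)
  qed
  ultimately have "sc_extension Y (defect q (f m) (f n)) z = 1"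
    by (simp add: excess_def R_def)
  moreover have "sc_extension Y (defect q (f m) (f n)) z \<le> 0"
    using supp[OF z(1)] f close unfolding supports_def by simp
  ultimately show False by simp
qed

text \<open>
  For a clopen subset \<open>P\<close> of \<open>Z\<close>, the points of \<open>F\<close> whose support meets \<open>P\<close> and those whose support
  misses \<open>P\<close> both form closed sets, which are disjoint by uniqueness. A connected subset of \<open>F\<close> lies in
  one of them. As clopen sets separate a point of \<open>Z\<close> from a finite set, the support is
  constant on connected subsets of \<open>F\<close>, and these are therefore trivial.
\<close>

lemma zero_dimensional_in_unique_support:
  fixes p :: nat
  assumes q: "q \<ge> 0" and F: "closedin W F" "F \<subseteq> supported p q"
    and unique: "\<And>w K L. w \<in> F \<Longrightarrow> K \<subseteq> topspace Z \<Longrightarrow> finite K \<Longrightarrow> card K \<le> p \<Longrightarrow> supports q w K \<Longrightarrow>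
      L \<subseteq> topspace Z \<Longrightarrow> finite L \<Longrightarrow> card L \<le> p \<Longrightarrow> supports q w L \<Longrightarrow> K = L"
  shows "zero_dimensional_in W F"
proof (rule totally_disconnected_imp_zero_dimensional_in[OF compact_stone_cech Hausdorff_stone_cech F(1)])
  fix C v w assume C: "connectedin W C" "C \<subseteq> F" and v: "v \<in> C" and w: "w \<in> C"
  have FW: "F \<subseteq> topspace W" using F(1) closedin_subset by blast
  define supp where "supp w k \<longleftrightarrow> k \<in> {..<p} \<rightarrow>\<^sub>E topspace Z \<and> supports q w (k ` {..<p})" for w k
  have ex: "\<exists>k. supp w k" if "w \<in> F" for w
    using F(2) that unfolding supp_def supported_iff_tuple by blast
  have same: "k ` {..<p} = l ` {..<p}" if "w \<in> F" "supp w k" "supp w l" for w k l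
  proof (rule unique[OF \<open>w \<in> F\<close>])
    show "card (k ` {..<p}) \<le> p" "card (l ` {..<p}) \<le> p"
      using card_image_le[of "{..<p}"] by fastforce+
  qed (use that in \<open>auto simp: supp_def\<close>)
  let ?P = "product_topology (\<lambda>_. Z) {..<p}"
  have subset: "k ` {..<p} \<subseteq> l ` {..<p}" if x: "x \<in> C" and y: "y \<in> C" and k: "supp x k" and l: "supp y l" for x y k l
  proof (rule ccontr)
    assume "\<not> k ` {..<p} \<subseteq> l ` {..<p}"
    then obtain i where i: "i < p" "k i \<notin> l ` {..<p}" by blast
    have kZ: "k i \<in> topspace Z" using k i by (auto simp: supp_def)
    have lZ: "l j \<in> topspace Z" if "j < p" for j using l that by (auto simp: supp_def)
    have "\<exists>Q. openin Z Q \<and> closedin Z Q \<and> k i \<in> Q \<and> l j \<notin> Q" if "j < p" for j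
      using clopen_separated[OF kZ lZ[OF that]] i that by blast
    then have "\<exists>Q. \<forall>j<p. openin Z (Q j) \<and> closedin Z (Q j) \<and> k i \<in> Q j \<and> l j \<notin> Q j"
      by metis
    then obtain Q where Q: "\<And>j. j < p \<Longrightarrow> openin Z (Q j)" "\<And>j. j < p \<Longrightarrow> closedin Z (Q j)"
      "\<And>j. j < p \<Longrightarrow> k i \<in> Q j" "\<And>j. j < p \<Longrightarrow> l j \<notin> Q j"
      by blast
    define P where "P = (\<Inter>j<p. Q j)"
    have "{..<p} \<noteq> {}" using i by auto
    then have P: "openin Z P" "closedin Z P"
      unfolding P_def using Q(1,2) by (auto intro!: openin_Inter closedin_Inter)
    have kP: "k i \<in> P" and lP: "\<And>j. j < p \<Longrightarrow> l j \<notin> P"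
      unfolding P_def using Q(3,4) by blast+
    have proj: "continuous_map ?P Z (\<lambda>k. k j)" if "j < p" for j
      using that by (intro continuous_map_product_projection) simp
    let ?E = "\<Union>j<p. {k \<in> topspace ?P. k j \<in> P}"
    have clE: "closedin ?P ?E"
      using closedin_continuous_map_preimage[OF proj P(2)] by (intro closedin_Union) auto
    have clE': "closedin ?P (topspace ?P - ?E)"
      using openin_continuous_map_preimage[OF proj P(1)]
      by (intro closedin_diff closedin_topspace openin_Union) auto
    let ?A = "{w \<in> topspace W. \<exists>k\<in>?E. supports q w (k ` {..<p})}"
    let ?B = "{w \<in> topspace W. \<exists>k\<in>topspace ?P - ?E. supports q w (k ` {..<p})}"
    have cl: "closedin W ?A" "closedin W ?B"
      by (rule closedin_supported_with[OF clE], rule closedin_supported_with[OF clE'])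
    have A: "z \<in> ?A \<longleftrightarrow> (\<exists>k. supp z k \<and> k ` {..<p} \<inter> P \<noteq> {})" if "z \<in> F" for z
    proof -
      have "z \<in> topspace W" using that FW by blast
      then show ?thesis unfolding supp_def by (auto simp: image_iff)
    qed
    have B: "z \<in> ?B \<longleftrightarrow> (\<exists>k. supp z k \<and> k ` {..<p} \<inter> P = {})" if "z \<in> F" for z
    proof -
      have "z \<in> topspace W" using that FW by blast
      then show ?thesis unfolding supp_def by (auto simp: image_iff) blast+
    qed
    have "C \<subseteq> ?A \<union> ?B"
    proof
      fix z assume "z \<in> C"
      then have "z \<in> F" using C by blast
      then show "z \<in> ?A \<union> ?B" using ex[of z] A[of z] B[of z] by blast
    qed
    moreover have "?A \<inter> ?B \<inter> C = {}"
    proof -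
      have False if zA: "z \<in> ?A" and zB: "z \<in> ?B" and zC: "z \<in> C" for z
      proof -
        have "z \<in> F" using zC C by blast
        obtain k where "supp z k" "k ` {..<p} \<inter> P \<noteq> {}"
          using A[OF \<open>z \<in> F\<close>, THEN iffD1, OF zA] by (elim exE conjE)
        moreover obtain l where "supp z l" "l ` {..<p} \<inter> P = {}"
          using B[OF \<open>z \<in> F\<close>, THEN iffD1, OF zB] by (elim exE conjE)
        ultimately show False using same[OF \<open>z \<in> F\<close>] by metis
      qed
      then show ?thesis by blast
    qed
    moreover have "x \<in> ?A"
      using A[of x] x C k kP i by blast
    moreover have "y \<in> ?B"
      using B[of y] y C l lP by blast
    ultimately show False
      using C(1) cl x y unfolding connectedin_closedin by blast
  qed
  obtain k where k: "supp v k" using ex v C by blast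
  have "supports q z (k ` {..<p})" if z: "z \<in> C" for z
  proof -
    obtain l where l: "supp z l" using ex z C by blast
    have "k ` {..<p} = l ` {..<p}"
      using subset[OF v z k l] subset[OF z v l k] by blast
    with l show ?thesis by (simp add: supp_def)
  qed
  moreover have "k ` {..<p} \<subseteq> topspace Z" using k by (auto simp: supp_def)
  ultimately show "v = w"
    using connected_common_support_trivial[OF q C(1), of "k ` {..<p}"] v w by blast
qed

text \<open>
  Induction on the size of the supports. A point outside \<open>supported p (q + q)\<close> has at most one
  \<open>q\<close>-support of size at most \<open>p + 1\<close>, since the intersection of two different ones would be a
  \<open>(q + q)\<close>-support of size at most \<open>p\<close>. At size \<open>0\<close> the only candidate is the empty set.
\<close>

lemma zero_dimensional_in_supported:
  assumes "q \<ge> 0"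
  shows "zero_dimensional_in W (supported p q)"
  using assms
proof (induction p arbitrary: q)
  case 0
  show ?case
    by (rule zero_dimensional_in_unique_support[OF \<open>q \<ge> 0\<close> closedin_supported order_refl]) simp
next
  case (Suc p)
  show ?case
  proof (rule zero_dimensional_in_extend[OF closedin_supported Suc.IH[of "q + q"]])
    show "0 \<le> q + q" using Suc.prems by simp
    fix F assume F: "closedin W F" "F \<subseteq> supported (Suc p) q" "disjnt F (supported p (q + q))"
    have "K = L" if w: "w \<in> F"
      and K: "K \<subseteq> topspace Z" "finite K" "card K \<le> Suc p" "supports q w K"
      and L: "L \<subseteq> topspace Z" "finite L" "card L \<le> Suc p" "supports q w L" for w K L
    proof -
      have wW: "w \<in> topspace W" using w F(1) closedin_subset by blast
      have "w \<notin> supported p (q + q)" using w F(3) by (auto simp: disjnt_iff)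
      moreover have "supports (q + q) w (K \<inter> L)"
        using supports_Int[OF wW K(2,1,4) L(2,1,4)] .
      ultimately have "\<not> card (K \<inter> L) \<le> p"
        using wW K(1,2) unfolding supported_def by blast
      then have "card K \<le> card (K \<inter> L)" "card L \<le> card (K \<inter> L)" using K(3) L(3) by auto
      then have "K \<inter> L = K" "K \<inter> L = L"
        using card_seteq[OF K(2) Int_lower1] card_seteq[OF L(2) Int_lower2] by simp_all
      then show "K = L" by blast
    qed
    then show "zero_dimensional_in W F"
      by (rule zero_dimensional_in_unique_support[OF Suc.prems F(1,2)])
  qed
qed

text \<open>
  The sets where the extension of \<open>h\<close> is at most \<open>0\<close> and at least \<open>1\<close> are separated in \<open>W\<close> across all
  sets \<open>supported p q\<close> with natural \<open>q\<close>. As these cover \<open>Y\<close>, the separation restricts to a clopen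
  partition of \<open>Y\<close>.
\<close>

lemma covering_dim_le_0: "covering_dim_le Y 0"
proof (rule clopen_separation_imp_covering_dim_le_0)
  fix h assume h: "bounded_continuous Y h"
  let ?A = "{w \<in> topspace W. sc_extension Y h w \<in> {..0}}" and ?B = "{w \<in> topspace W. sc_extension Y h w \<in> {1..}}"
  have AB: "closedin W ?A" "closedin W ?B" "disjnt ?A ?B"
    by (intro closedin_continuous_map_preimage[OF continuous_sc_extension[OF h]] closed_atMost closed_atLeast;
        simp add: disjnt_iff)+ (simp add: disjnt_iff)
  define M where "M n = (case prod_decode n of (p, q) \<Rightarrow> supported p (real q))" for n
  have "zero_dimensional_in W (M n)" for n
    by (auto simp: M_def zero_dimensional_in_supported split: prod.split)
  from zero_dimensional_in_countable_Union[OF this AB] obtain U V where UV: "openin W U" "openin W V"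
    "?A \<subseteq> U" "?B \<subseteq> V" "(\<Union>n. M n) \<subseteq> U \<union> V" "disjnt U V" .
  have M: "evaluation_at Y y \<in> (\<Union>n. M n)" if y: "y \<in> topspace Y" for y
  proof -
    obtain p q where "evaluation_at Y y \<in> supported p (real q)"
      using point_supported[OF y] by blast
    then have "evaluation_at Y y \<in> M (prod_encode (p, q))" by (simp add: M_def)
    then show ?thesis by blast
  qed
  let ?P = "{y \<in> topspace Y. evaluation_at Y y \<in> U}" and ?Q = "{y \<in> topspace Y. evaluation_at Y y \<in> V}"
  have op: "openin Y ?P" "openin Y ?Q"
    using UV(1,2) openin_continuous_map_preimage[OF continuous_map_evaluation_at] by auto
  have "?P = topspace Y - ?Q"
    using M UV(5,6) unfolding disjnt_iff by blast
  then have "closedin Y ?P"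
    using closedin_diff[OF closedin_topspace op(2)] by simp
  moreover have "{y \<in> topspace Y. h y \<le> 0} \<subseteq> ?P"
    using UV(3) by (auto simp: sc_extension_evaluation_at h evaluation_at_in_stone_cech)
  moreover have "?P \<subseteq> {y \<in> topspace Y. h y < 1}"
  proof (intro subsetI CollectI conjI)
    fix y assume y: "y \<in> ?P"
    show "h y < 1"
    proof (rule ccontr)
      assume "\<not> h y < 1"
      then have "evaluation_at Y y \<in> ?B"
        using y by (auto simp: sc_extension_evaluation_at h evaluation_at_in_stone_cech)
      then show False using UV(4,6) y by (auto simp: disjnt_iff)
    qed
  qed auto
  ultimately show "\<exists>P. openin Y P \<and> closedin Y P \<and> {y \<in> topspace Y. h y \<le> 0} \<subseteq> P \<and> P \<subseteq> {y \<in> topspace Y. h y < 1}"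
    using op(1) by blast
qed

end

section \<open>Passing to the compactifications\<close>

text \<open>
  A clopen set \<open>P\<close> of \<open>X\<close> between \<open>h \<le> a\<close> and \<open>h < b\<close> has an indicator whose extension takes
  only the values \<open>0\<close> and \<open>1\<close>, by density. The extension is \<open>1\<close> where that of \<open>h\<close> is
  below \<open>a\<close> and \<open>0\<close> where it is above \<open>b\<close>.
\<close>

lemma stone_cech_clopen_separated:
  assumes dim: "covering_dim_le X 0" and v: "v \<in> topspace (stone_cech X)"
    and w: "w \<in> topspace (stone_cech X)" and "v \<noteq> w"
  shows "\<exists>Q. openin (stone_cech X) Q \<and> closedin (stone_cech X) Q \<and> v \<in> Q \<and> w \<notin> Q"
proof -
  obtain h where h: "bounded_continuous X h" and less: "sc_extension X h v < sc_extension X h w"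
    using stone_cech_separated[OF v w \<open>v \<noteq> w\<close>] .
  obtain a where a: "sc_extension X h v < a" "a < sc_extension X h w" using dense[OF less] by blast
  obtain b where b: "a < b" "b < sc_extension X h w" using dense[OF a(2)] by blast
  obtain P where P: "openin X P" "closedin X P" "{x \<in> topspace X. h x \<le> a} \<subseteq> P"
    "P \<subseteq> {x \<in> topspace X. h x < b}"
    using covering_dim_le_0_imp_clopen_separation[OF dim _ b(1), of h] h
    unfolding bounded_continuous_def by blast
  let ?\<chi> = "indicator P :: 'a \<Rightarrow> real"
  have \<chi>: "bounded_continuous X ?\<chi>"
    by (rule bounded_continuousI[OF clopen_indicator_continuous[OF P(1,2)], of 1]) (simp add: indicator_def)
  let ?H = "sc_extension X h" and ?E = "sc_extension X ?\<chi>"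
  have pre: "closedin (stone_cech X) {z \<in> topspace (stone_cech X). ?H z \<in> A}"
    "closedin (stone_cech X) {z \<in> topspace (stone_cech X). ?E z \<in> A}" if "closed A" for A
    using that closedin_continuous_map_preimage[OF continuous_sc_extension] h \<chi> by auto
  have "v \<in> {z \<in> topspace (stone_cech X). ?H z \<in> {a..}} \<union> {z \<in> topspace (stone_cech X). ?E z \<in> {1..}}"
    using P(3)
    by (intro stone_cech_dense[OF closedin_Un[OF pre] _ v])
      (auto simp: sc_extension_evaluation_at h \<chi> evaluation_at_in_stone_cech indicator_def)
  then have v1: "?E v \<ge> 1" using a by auto
  have "w \<in> {z \<in> topspace (stone_cech X). ?H z \<in> {..b}} \<union> {z \<in> topspace (stone_cech X). ?E z \<in> {..0}}"
    using P(4)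
    by (intro stone_cech_dense[OF closedin_Un[OF pre] _ w])
      (auto simp: sc_extension_evaluation_at h \<chi> evaluation_at_in_stone_cech indicator_def)
  then have w0: "?E w \<le> 0" using b by auto
  have zo: "z \<in> {z \<in> topspace (stone_cech X). ?E z \<in> {0, 1}}" if "z \<in> topspace (stone_cech X)" for z
    by (intro stone_cech_dense[OF pre(2) _ that])
      (auto simp: sc_extension_evaluation_at \<chi> evaluation_at_in_stone_cech indicator_def)
  let ?Q = "{z \<in> topspace (stone_cech X). ?E z \<in> {1/2<..}}"
  have "openin (stone_cech X) ?Q"
    by (intro openin_continuous_map_preimage[OF continuous_sc_extension[OF \<chi>]]) simp
  moreover have "?Q = {z \<in> topspace (stone_cech X). ?E z \<in> {1/2..}}"
    using zo by force
  then have "closedin (stone_cech X) ?Q" using pre(2)[of "{1/2..}"] by simp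
  ultimately show ?thesis using v w0 v1 by (intro exI[of _ ?Q]) auto
qed

lemma bounded_function_set_subset: "function_set Bounded_Continuous X \<subseteq> function_set D X"
  by (cases D) auto

text \<open>
  Functions on the compactification are bounded, so their restrictions belong to the function space
  for either meaning of \<open>D\<close>.
\<close>

lemma restriction_to_space:
  assumes "continuous_map (stone_cech X) euclideanreal f"
  shows "(\<lambda>x\<in>topspace X. f (evaluation_at X x)) \<in> function_set Bounded_Continuous X"
proof (rule restrict_bounded_continuous)
  have "compactin euclideanreal (f ` topspace (stone_cech X))"
    using image_compactin[OF compact_stone_cech[unfolded compact_space_def] assms] .
  then have "bounded (f ` topspace (stone_cech X))"
    using compact_imp_bounded by simp
  then obtain r where "\<And>z. z \<in> topspace (stone_cech X) \<Longrightarrow> \<bar>f z\<bar> \<le> r"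
    by (auto simp: bounded_real)
  then show "bounded_continuous X (\<lambda>x. f (evaluation_at X x))"
    using continuous_map_compose[OF continuous_map_evaluation_at assms]
    by (intro bounded_continuousI[of _ _ r]) (auto simp: o_def evaluation_at_in_stone_cech)
qed

lemma pointwise_neighbourhood_of_zero:
  assumes V: "openin (pointwise_space D X) V" "zero_fun X \<in> V"
  obtains K \<epsilon> where "finite K" "K \<subseteq> topspace X" "\<epsilon> > 0"
    "\<And>f. f \<in> function_set D X \<Longrightarrow> (\<And>x. x \<in> K \<Longrightarrow> \<bar>f x\<bar> < \<epsilon>) \<Longrightarrow> f \<in> V"
proof -
  obtain V' where V': "openin (powertop_real (topspace X)) V'" "V = V' \<inter> function_set D X"
    using V(1) by (auto simp: pointwise_space_def openin_subtopology)
  then have "zero_fun X \<in> V'" using V(2) by auto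
  then obtain B where B: "finite {x \<in> topspace X. B x \<noteq> UNIV}" "\<And>x. x \<in> topspace X \<Longrightarrow> open (B x)"
    "zero_fun X \<in> PiE (topspace X) B" "PiE (topspace X) B \<subseteq> V'"
    using V'(1) unfolding openin_product_topology_alt by force
  let ?K = "{x \<in> topspace X. B x \<noteq> UNIV}"
  have "\<exists>e>0. ball 0 e \<subseteq> B x" if "x \<in> topspace X" for x
  proof -
    have "0 \<in> B x" using B(3) that by (auto simp: zero_fun_def PiE_iff)
    then show ?thesis using B(2)[OF that] open_contains_ball by blast
  qed
  then obtain e where e: "\<And>x. x \<in> topspace X \<Longrightarrow> e x > 0" "\<And>x. x \<in> topspace X \<Longrightarrow> ball 0 (e x) \<subseteq> B x"
    by metis
  let ?\<epsilon> = "Min (insert 1 (e ` ?K))"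
  show ?thesis
  proof (rule that[of ?K ?\<epsilon>])
    show "finite ?K" "?K \<subseteq> topspace X" using B(1) by auto
    show "?\<epsilon> > 0" using B(1) e(1) by (subst Min_gr_iff) auto
    fix f assume f: "f \<in> function_set D X" and small: "\<And>x. x \<in> ?K \<Longrightarrow> \<bar>f x\<bar> < ?\<epsilon>"
    have "f x \<in> B x" if x: "x \<in> topspace X" for x
    proof (cases "B x = UNIV")
      case False
      then have "x \<in> ?K" using x by simp
      have "?\<epsilon> \<le> e x" using B(1) \<open>x \<in> ?K\<close> by (intro Min_le) auto
      with small[OF \<open>x \<in> ?K\<close>] have "f x \<in> ball 0 (e x)" by simp
      then show ?thesis using e(2)[OF x] by blast
    qed simp
    moreover have "f \<in> extensional (topspace X)" using f by (cases D) auto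
    ultimately have "f \<in> PiE (topspace X) B" by (simp add: PiE_iff)
    then show "f \<in> V" using B(4) V'(2) f by blast
  qed
qed

lemma uniformly_continuous_Dp_finitely_determined:
  assumes uc: "uniformly_continuous_Dp D X Y T" and T: "T ` function_set D X \<subseteq> function_set D Y"
    and y: "y \<in> topspace Y"
  obtains K \<epsilon> where "finite K" "K \<subseteq> topspace X" "\<epsilon> > 0"
    "\<And>f g. f \<in> function_set D X \<Longrightarrow> g \<in> function_set D X \<Longrightarrow> diff_fun X f g \<in> function_set D X \<Longrightarrow>
       (\<And>x. x \<in> K \<Longrightarrow> \<bar>f x - g x\<bar> < \<epsilon>) \<Longrightarrow> \<bar>T f y - T g y\<bar> < 1"
proof -
  let ?U = "{u \<in> topspace (pointwise_space D Y). u y \<in> {-1<..<1}}"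
  have "continuous_map (pointwise_space D Y) euclideanreal (\<lambda>u. u y)"
    unfolding pointwise_space_def
    by (intro continuous_map_from_subtopology continuous_map_product_projection y)
  then have "openin (pointwise_space D Y) ?U"
    by (rule openin_continuous_map_preimage) simp
  moreover have "zero_fun Y \<in> function_set D Y"
  proof -
    have "bounded_continuous Y (\<lambda>_. 0)" by (rule bounded_continuousI[of _ _ 0]) auto
    from restrict_bounded_continuous[OF this] show ?thesis
      using bounded_function_set_subset unfolding zero_fun_def by blast
  qed
  then have "zero_fun Y \<in> ?U" using y by (simp add: zero_fun_def)
  ultimately obtain V where V: "openin (pointwise_space D X) V" "zero_fun X \<in> V"
    and VU: "\<And>f g. f \<in> function_set D X \<Longrightarrow> g \<in> function_set D X \<Longrightarrow> diff_fun X f g \<in> V \<Longrightarrow>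
      diff_fun Y (T f) (T g) \<in> ?U"
    using uc unfolding uniformly_continuous_Dp_def by (metis (no_types, lifting))
  obtain K \<epsilon> where K: "finite K" "K \<subseteq> topspace X" "\<epsilon> > 0"
    "\<And>f. f \<in> function_set D X \<Longrightarrow> (\<And>x. x \<in> K \<Longrightarrow> \<bar>f x\<bar> < \<epsilon>) \<Longrightarrow> f \<in> V"
    using pointwise_neighbourhood_of_zero[OF V] by metis
  show ?thesis
  proof (rule that[OF K(1-3)])
    fix f g assume f: "f \<in> function_set D X" and g: "g \<in> function_set D X"
      and fg: "diff_fun X f g \<in> function_set D X" and small: "\<And>x. x \<in> K \<Longrightarrow> \<bar>f x - g x\<bar> < \<epsilon>"
    have "diff_fun X f g \<in> V"
    proof (rule K(4)[OF fg])
      show "\<bar>diff_fun X f g x\<bar> < \<epsilon>" if "x \<in> K" for x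
        using small[OF that] K(2) that by (auto simp: diff_fun_def)
    qed
    from VU[OF f g this] show "\<bar>T f y - T g y\<bar> < 1"
      using y by (simp add: diff_fun_def abs_less_iff)
  qed
qed

lemma abs_le_sup_norm:
  assumes "bounded_on_space X f" "x \<in> topspace X"
  shows "\<bar>f x\<bar> \<le> sup_norm X f"
proof -
  obtain r where "\<forall>x\<in>topspace X. \<bar>f x\<bar> \<le> r"
    using assms(1) by (auto simp: bounded_on_space_def bounded_real)
  then have "bdd_above ((\<lambda>x. \<bar>f x\<bar>) ` topspace X)" by (auto intro: bdd_aboveI2)
  then show ?thesis unfolding sup_norm_def by (rule cSUP_upper[OF assms(2)])
qed

text \<open>
  A bounded preimage under \<open>T\<close> extends to the compactification of \<open>X\<close> with the same bound, so that
  \<open>c\<close>-goodness survives the passage to functions on the compactification.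
\<close>

lemma good_operator_stone_cech:
  assumes "topspace X \<noteq> {}" and "topspace Y \<noteq> {}"
    and T: "T ` function_set D X \<subseteq> function_set D Y"
    and uc: "uniformly_continuous_Dp D X Y T"
    and "c > 0" and good: "c_good c D X Y T" and dim: "covering_dim_le X 0"
  shows "good_operator (stone_cech X) Y (\<lambda>f. T (\<lambda>x\<in>topspace X. f (evaluation_at X x))) c"
proof
  let ?r = "\<lambda>f. \<lambda>x\<in>topspace X. f (evaluation_at X x)"
  have r: "?r f \<in> function_set D X" if "continuous_map (stone_cech X) euclideanreal f" for f
    using restriction_to_space[OF that] bounded_function_set_subset by blast
  have TY: "continuous_map Y euclideanreal (T f)" if "f \<in> function_set D X" for f
  proof -
    have "T f \<in> function_set D Y" using T that by blast
    then show ?thesis by (cases D) auto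
  qed
  show "compact_space (stone_cech X)" "Hausdorff_space (stone_cech X)"
    by (rule compact_stone_cech Hausdorff_stone_cech)+
  show "topspace (stone_cech X) \<noteq> {}"
    using \<open>topspace X \<noteq> {}\<close> evaluation_at_in_stone_cech by fastforce
  show "\<exists>P. openin (stone_cech X) P \<and> closedin (stone_cech X) P \<and> x \<in> P \<and> z \<notin> P"
    if "x \<in> topspace (stone_cech X)" "z \<in> topspace (stone_cech X)" "x \<noteq> z" for x z
    using stone_cech_clopen_separated[OF dim that] .
  show "continuous_map Y euclideanreal (T (?r f))" if "continuous_map (stone_cech X) euclideanreal f" for f
    using TY r that by blast
  show "\<exists>K \<epsilon>. finite K \<and> K \<subseteq> topspace (stone_cech X) \<and> \<epsilon> > 0 \<and>
      (\<forall>f g. continuous_map (stone_cech X) euclideanreal f \<longrightarrow>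
         continuous_map (stone_cech X) euclideanreal g \<longrightarrow>
         (\<forall>x\<in>K. \<bar>f x - g x\<bar> < \<epsilon>) \<longrightarrow> \<bar>T (?r f) y - T (?r g) y\<bar> < 1)"
    if y: "y \<in> topspace Y" for y
  proof -
    obtain K \<epsilon> where K: "finite K" "K \<subseteq> topspace X" "\<epsilon> > 0"
      "\<And>f g. f \<in> function_set D X \<Longrightarrow> g \<in> function_set D X \<Longrightarrow> diff_fun X f g \<in> function_set D X \<Longrightarrow>
         (\<And>x. x \<in> K \<Longrightarrow> \<bar>f x - g x\<bar> < \<epsilon>) \<Longrightarrow> \<bar>T f y - T g y\<bar> < 1"
      using uniformly_continuous_Dp_finitely_determined[OF uc T y] by metis
    show ?thesis
    proof (intro exI[of _ "evaluation_at X ` K"] exI[of _ \<epsilon>] conjI allI impI)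
      show "evaluation_at X ` K \<subseteq> topspace (stone_cech X)"
        using K(2) evaluation_at_in_stone_cech[of _ X] by (auto simp only: image_subset_iff subset_iff)
      fix f g assume f: "continuous_map (stone_cech X) euclideanreal f"
        and g: "continuous_map (stone_cech X) euclideanreal g"
        and small: "\<forall>x\<in>evaluation_at X ` K. \<bar>f x - g x\<bar> < \<epsilon>"
      have "diff_fun X (?r f) (?r g) = ?r (\<lambda>z. f z - g z)"
        by (auto simp: diff_fun_def)
      then have "diff_fun X (?r f) (?r g) \<in> function_set D X"
        using r[OF continuous_map_diff[OF f g]] by simp
      then show "\<bar>T (?r f) y - T (?r g) y\<bar> < 1"
        using small K(2) by (intro K(4) r f g) auto
    qed (use K in auto)
  qed
  show "\<exists>f. continuous_map (stone_cech X) euclideanreal f \<and>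
      (\<forall>x\<in>topspace (stone_cech X). \<bar>f x\<bar> \<le> c * s) \<and> (\<forall>y\<in>topspace Y. T (?r f) y = g y)"
    if g: "continuous_map Y euclideanreal g" and gs: "\<And>y. y \<in> topspace Y \<Longrightarrow> \<bar>g y\<bar> \<le> s" for g s
  proof -
    let ?g = "restrict g (topspace Y)"
    have gf: "?g \<in> function_set Bounded_Continuous Y"
      by (intro restrict_bounded_continuous bounded_continuousI[OF g gs])
    then have "bounded_on_space Y ?g" "?g \<in> function_set D Y"
      using bounded_function_set_subset[of Y D] by (simp, blast)
    then obtain f where f: "f \<in> function_set D X" "bounded_on_space X f" "T f = ?g"
      "sup_norm X f \<le> c * sup_norm Y ?g"
      using good unfolding c_good_def by blast
    have ext: "f \<in> extensional (topspace X)" and "continuous_map X euclideanreal f"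
      using f(1) by (cases D; simp)+
    then have bf: "bounded_continuous X f" using f(2) by (simp add: bounded_continuous_def)
    have "sup_norm Y ?g \<le> s"
      unfolding sup_norm_def using gs \<open>topspace Y \<noteq> {}\<close> by (intro cSUP_least) auto
    then have "c * sup_norm Y ?g \<le> c * s" using \<open>c > 0\<close> by simp
    then have fs: "\<bar>f x\<bar> \<le> c * s" if "x \<in> topspace X" for x
      using abs_le_sup_norm[OF f(2) that] f(4) by linarith
    have "\<bar>sc_extension X f z\<bar> \<le> c * s" if "z \<in> topspace (stone_cech X)" for z
    proof -
      have "closedin (stone_cech X) {z \<in> topspace (stone_cech X). sc_extension X f z \<in> {- (c * s)..c * s}}"
        by (intro closedin_continuous_map_preimage[OF continuous_sc_extension[OF bf]]) simp
      from stone_cech_dense[OF this _ that] show ?thesis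
        using fs by (auto simp: sc_extension_evaluation_at bf evaluation_at_in_stone_cech abs_le_iff minus_le_iff)
    qed
    moreover have "?r (sc_extension X f) = f"
      using ext by (auto simp: sc_extension_evaluation_at bf extensional_def)
    ultimately show ?thesis
      using continuous_sc_extension[OF bf] f(3) by (intro exI[of _ "sc_extension X f"]) auto
  qed
qed

theorem theorem1p1:
  fixes X :: "'a topology" and Y :: "'b topology"
    and D :: function_class
    and T :: "('a \<Rightarrow> real) \<Rightarrow> ('b \<Rightarrow> real)"
    and c :: real
  assumes "tychonoff_space X" and "topspace X \<noteq> {}"
    and "tychonoff_space Y" and "topspace Y \<noteq> {}"
    and "T ` function_set D X = function_set D Y"
    and "uniformly_continuous_Dp D X Y T"
    and "c > 0" and "c_good c D X Y T"
    and "zero_dimensional X"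
  shows "zero_dimensional Y"
proof -
  have "good_operator (stone_cech X) Y (\<lambda>f. T (\<lambda>x\<in>topspace X. f (evaluation_at X x))) c"
    using assms by (intro good_operator_stone_cech[of X Y T D]) (auto simp: zero_dimensional_iff)
  then show ?thesis
    unfolding zero_dimensional_iff by (rule good_operator.covering_dim_le_0)
qed

end
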